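(* Let $k$ be a complete valuation field and let $V$ be a Banach $k$-vector space. If $\#V=\mathrm{rank}(V)$ and the cardinal $\mathrm{rank}(V)$ is regular, then the following are equivalent: (1) $V$ is almost free. (2) $V$ admits a free filtration.
   Context: $\#X$ denotes the cardinality of the underlying set of $X$. A complete valuation field is a field $k$ with a map $|\cdot|:k\to\mathbb{R}_{\ge 0}$ such that $|c|=0$ iff $c=0$, $|c_0-c_1|\le\max\{|c_0|,|c_1|\}$, $|c_0c_1|=|c_0||c_1|$, and $k$ is complete for the ultrametric $|c_0-c_1|$ (the trivial valuation is allowed). A Banach $k$-vector space is a $k$-vector space $V$ with a map $\|\cdot\|:V\to\mathbb{R}_{\ge 0}$ such that $\|v\|=0$ iff $v=0$, $\|v_0-v_1\|\le\max\{\|v_0\|,\|v_1\|\}$, $\|cv\|=|c|\|v\|$, and $V$ is complete for the ultrametric $\|v_0-v_1\|$. Closed $k$-linear subspaces carry the restricted norm and are Banach $k$-vector spaces. For a set $E$, $C_0(E,k)$ is the Banach $k$-vector space of maps $c:E\to k$ such that $\{e\in E:|c(e)|\ge\epsilon\}$ is finite for every $\epsilon>0$, with the norm $\|c\|=\sup_{e\in E}|c(e)|$ (equal to $0$ if $E=\emptyset$). An orthonormal Schauder basis of $V$ is a subset $E\subset V$ such that $\|e\|=1$ for all $e\in E$; $\|\sum_{e\in E}c(e)e\|=\|c\|$ for all $c\in C_0(E,k)$; and every $v\in V$ equals $\sum_{e\in E}c(e)e$ for some $c\in C_0(E,k)$ (the sums being the usual limits of finite sums). For $S\subset V$, $\langle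 S\rangle$ is the closure of the $k$-linear span of $S$. $\mathrm{rank}(V)$ is the minimum cardinality of a subset $S\subset V$ with $V=\langle S\rangle$. For a cardinal $\kappa$, $\mathcal{L}_{<\kappa}(V)=\{\langle S\rangle : S\subset V,\ \#S<\kappa\}$. $V$ is free if it admits an orthonormal Schauder basis; $V$ is $\kappa$-free if every $V'\in\mathcal{L}_{<\kappa}(V)$ is free; $V$ is almost free if it is $\mathrm{rank}(V)$-free. With $\kappa=\mathrm{rank}(V)$, a free filtration of $V$ is a map $\mathcal{V}:\kappa\to\mathcal{L}_{<\kappa}(V)$ such that: $\mathcal{V}(\alpha)$ is free for every $\alpha\in\kappa$; $\mathcal{V}(\beta)\subset\mathcal{V}(\alpha)$ for all $\beta\in\alpha\in\kappa$; $\mathcal{V}(\alpha)=\langle\bigcup_{\beta\in\alpha}\mathcal{V}(\beta)\rangle$ for every non-zero limit ordinal $\alpha\in\kappa$; and $V=\bigcup_{\beta\in\kappa}\mathcal{V}(\beta)$. *)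

theory Defs
  imports "HOL-Analysis.Analysis"
begin

unbundle cardinal_syntax

text \<open>
  Complete ultrametric groups, common to scalars and vectors. A fresh constant is needed because
  the library constrains its norm to real normed vector spaces. Nonnegativity follows from
  \<open>dist_unorm\<close>.
\<close>

class complete_ultranormed_group = ab_group_add + complete_space +
  fixes unorm :: "'a \<Rightarrow> real"
  assumes dist_unorm: "dist x y = unorm (x - y)"
    and unorm_eq_zero: "unorm x = 0 \<longleftrightarrow> x = 0"
    and unorm_diff_le: "unorm (x - y) \<le> max (unorm x) (unorm y)"

class complete_valuation_field = field + complete_ultranormed_group +
  assumes unorm_mult: "unorm (x * y) = unorm x * unorm y"

locale banach_kvs = vector_space scl
  for scl :: "'k::complete_valuation_field \<Rightarrow> 'v::complete_ultranormed_group \<Rightarrow> 'v" +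
  assumes unorm_scale: "unorm (scl c v) = unorm c * unorm v"

text \<open>
  \<open>C\<^sub>0(E,k)\<close>: maps on \<open>E\<close> are represented by total functions, of which only the values on \<open>E\<close>
  are ever used.
\<close>

definition C0 :: "'e set \<Rightarrow> ('e \<Rightarrow> 'k::complete_valuation_field) set" where
  "C0 E = {c. \<forall>\<epsilon>>0. finite {e \<in> E. \<epsilon> \<le> unorm (c e)}}"

definition C0_norm :: "'e set \<Rightarrow> ('e \<Rightarrow> 'k::complete_valuation_field) \<Rightarrow> real" where
  "C0_norm E c = (if E = {} then 0 else SUP e\<in>E. unorm (c e))"

definition closed_lin_span ::
  "('k::complete_valuation_field \<Rightarrow> 'v::complete_ultranormed_group \<Rightarrow> 'v) \<Rightarrow> 'v set \<Rightarrow> 'v set"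
  where "closed_lin_span scl S = closure (module.span scl S)"

text \<open>
  The next two notions are used for closed linear subspaces \<open>W\<close>, regarded as Banach spaces with
  the restricted unorm; limits in \<open>W\<close> and in the ambient space then agree. The sums over
  \<open>c \<in> C0 E\<close> converge since all basis vectors have unorm one and the space is complete.
\<close>

definition orthonormal_schauder_basis ::
  "('k::complete_valuation_field \<Rightarrow> 'v::complete_ultranormed_group \<Rightarrow> 'v) \<Rightarrow> 'v set \<Rightarrow> 'v set \<Rightarrow> bool"
  where "orthonormal_schauder_basis scl W E \<longleftrightarrow>
    E \<subseteq> W \<and>
    (\<forall>e\<in>E. unorm e = 1) \<and>
    (\<forall>c\<in>C0 E. unorm (\<Sum>\<^sub>\<infinity>e\<in>E. scl (c e) e) = C0_norm E c) \<and>
    (\<forall>v\<in>W. \<exists>c\<in>C0 E. v = (\<Sum>\<^sub>\<infinity>e\<in>E. scl (c e) e))"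

definition free_subspace ::
  "('k::complete_valuation_field \<Rightarrow> 'v::complete_ultranormed_group \<Rightarrow> 'v) \<Rightarrow> 'v set \<Rightarrow> bool"
  where "free_subspace scl W \<longleftrightarrow> (\<exists>E. orthonormal_schauder_basis scl W E)"

text \<open>
  Cardinals are well-order relations \<open>r\<close> with \<^term>\<open>Card_order r\<close>; the elements of \<^term>\<open>Field r\<close>
  play the role of the ordinals below \<open>r\<close>, and \<^term>\<open>underS r \<alpha>\<close> is the set of those less than
  \<open>\<alpha>\<close>. The rank is \<open>|S|\<close> for some choice of a topologically generating set \<open>S\<close> of least
  cardinality, hence is determined up to order isomorphism.
\<close>

definition banach_rank ::
  "('k::complete_valuation_field \<Rightarrow> 'v::complete_ultranormed_group \<Rightarrow> 'v) \<Rightarrow> 'v rel"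
  where "banach_rank scl = |SOME S. closed_lin_span scl S = UNIV \<and>
                         (\<forall>T. closed_lin_span scl T = UNIV \<longrightarrow> |S| \<le>o |T| )|"

lemma (in banach_kvs) rank_minimal:
  shows "Card_order (banach_rank scl)"
    and "\<exists>S. closed_lin_span scl S = UNIV \<and> |S| =o banach_rank scl"
    and "closed_lin_span scl T = UNIV \<Longrightarrow> banach_rank scl \<le>o |T|"
proof -
  let ?G = "{S. closed_lin_span scl S = UNIV}"
  have "UNIV \<in> ?G"
    by (simp add: closed_lin_span_def)
  then obtain r where "r \<in> card_of ` ?G" "\<forall>r'\<in>card_of ` ?G. r \<le>o r'"
    using exists_minim_Card_order[of "card_of ` ?G"] card_of_Card_order by blast
  then have "\<exists>S. closed_lin_span scl S = UNIV \<and> (\<forall>T. closed_lin_span scl T = UNIV \<longrightarrow> |S| \<le>o |T| )"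
    by auto
  from someI_ex[OF this]
  obtain S where S: "banach_rank scl = |S|" "closed_lin_span scl S = UNIV"
      "\<forall>T. closed_lin_span scl T = UNIV \<longrightarrow> |S| \<le>o |T|"
    unfolding banach_rank_def by blast
  show "Card_order (banach_rank scl)"
    by (simp add: S(1) card_of_Card_order)
  show "\<exists>S. closed_lin_span scl S = UNIV \<and> |S| =o banach_rank scl"
    using S(1,2) card_of_refl by auto
  show "closed_lin_span scl T = UNIV \<Longrightarrow> banach_rank scl \<le>o |T|"
    using S(1,3) by auto
qed

definition small_subspaces ::
  "('k::complete_valuation_field \<Rightarrow> 'v::complete_ultranormed_group \<Rightarrow> 'v) \<Rightarrow> 'c rel \<Rightarrow> 'v set set"
  where "small_subspaces scl \<kappa> = {closed_lin_span scl S | S. |S| <o \<kappa>}"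

definition kappa_free ::
  "('k::complete_valuation_field \<Rightarrow> 'v::complete_ultranormed_group \<Rightarrow> 'v) \<Rightarrow> 'c rel \<Rightarrow> bool"
  where "kappa_free scl \<kappa> \<longleftrightarrow> (\<forall>W\<in>small_subspaces scl \<kappa>. free_subspace scl W)"

definition almost_free ::
  "('k::complete_valuation_field \<Rightarrow> 'v::complete_ultranormed_group \<Rightarrow> 'v) \<Rightarrow> bool"
  where "almost_free scl \<longleftrightarrow> kappa_free scl (banach_rank scl)"

definition nonzero_limit :: "'c rel \<Rightarrow> 'c \<Rightarrow> bool" where
  "nonzero_limit r \<alpha> \<longleftrightarrow>
    underS r \<alpha> \<noteq> {} \<and> (\<forall>\<beta>\<in>underS r \<alpha>. \<exists>\<gamma>\<in>underS r \<alpha>. \<beta> \<in> underS r \<gamma>)"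

definition free_filtration ::
  "('k::complete_valuation_field \<Rightarrow> 'v::complete_ultranormed_group \<Rightarrow> 'v) \<Rightarrow> ('v \<Rightarrow> 'v set) \<Rightarrow> bool"
  where "free_filtration scl F \<longleftrightarrow>
    (let \<kappa> = banach_rank scl in
      (\<forall>\<alpha>\<in>Field \<kappa>. F \<alpha> \<in> small_subspaces scl \<kappa>) \<and>
      (\<forall>\<alpha>\<in>Field \<kappa>. free_subspace scl (F \<alpha>)) \<and>
      (\<forall>\<alpha>\<in>Field \<kappa>. \<forall>\<beta>\<in>underS \<kappa> \<alpha>. F \<beta> \<subseteq> F \<alpha>) \<and>
      (\<forall>\<alpha>\<in>Field \<kappa>. nonzero_limit \<kappa> \<alpha> \<longrightarrow>
        F \<alpha> = closed_lin_span scl (\<Union>\<beta>\<in>underS \<kappa> \<alpha>. F \<beta>)) \<and>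
      (UNIV = (\<Union>\<beta>\<in>Field \<kappa>. F \<beta>)))"

end

theory Submission
  imports Defs
begin

text \<open>
  If \<open>V\<close> is almost free, enumerate \<open>V\<close> in the order type of its rank; the closed spans of the proper
  initial segments form a filtration, and its members are free by assumption.

  Conversely, let a free filtration be given and let \<open>W\<close> be the closed span of fewer than
  \<open>rank V\<close> vectors. By regularity of the rank these vectors all lie in one member of the filtration,
  hence so does \<open>W\<close>, and \<open>W\<close> is free because subspaces of free spaces are free. This
  last fact is Gruson's theorem (\<open>free_subspace_subset\<close>), which takes up most of the text.

  For Gruson's theorem, view the subspace \<open>D\<close> inside \<open>C\<^sub>0(E, k)\<close>. Call \<open>A \<subseteq> E\<close> good if each \<open>d \<in> D\<close> can
  be corrected by an element of \<open>D\<close> supported in \<open>A\<close> so that its norm becomes at most the supremum of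
  the norms of its coordinates outside \<open>A\<close>. Unions of chains of good sets are good, as only finitely many coordinates
  of a vector exceed a given positive bound. A good set \<open>A\<close> can be enlarged to a good set containing a
  prescribed index by adjoining countably many indices (\<open>good_extension_countable\<close>): the required
  corrections come from submodules, over the valuation ring, of the spaces \<open>k\<^sup>F\<close> with \<open>F\<close> finite, and
  such submodules are countably generated (\<open>countable_generators\<close>). In the enlarged set, the
  vectors of \<open>D\<close> are limits, modulo those supported in \<open>A\<close>, of combinations of countably many vectors,
  which a Gram-Schmidt process with pivots makes orthonormal (\<open>gram_schmidt\<close>). Goodness of \<open>A\<close> lifts the
  result to vectors of norm one, extending any orthonormal basis of the part supported in \<open>A\<close>
  (\<open>orthonormal_extension\<close>). Zorn's lemma exhausts \<open>E\<close>. Passing through countable steps is essential: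
  extending by single indices would fail, since distances to closed subspaces need not be attained.
\<close>

section \<open>Ultrametric norms\<close>

lemma unorm_zero [simp]: "unorm (0::'a::complete_ultranormed_group) = 0"
  by (simp add: unorm_eq_zero)

lemma unorm_ge_zero [simp]: "0 \<le> unorm (x::'a::complete_ultranormed_group)"
  using dist_unorm[of x 0] zero_le_dist[of x 0] by simp

lemma unorm_minus [simp]: "unorm (- x) = unorm (x::'a::complete_ultranormed_group)"
  using dist_unorm[of x 0] dist_unorm[of 0 x] by (simp add: dist_commute)

lemma unorm_minus_commute: "unorm (x - y) = unorm (y - (x::'a::complete_ultranormed_group))"
  using unorm_minus[of "x - y"] by simp

lemma unorm_add_le: "unorm (x + y) \<le> max (unorm x) (unorm (y::'a::complete_ultranormed_group))"
  using unorm_diff_le[of x "- y"] by simp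

lemma unorm_add_leI:
  "unorm x \<le> r \<Longrightarrow> unorm y \<le> r \<Longrightarrow> unorm (x + y) \<le> r" for x :: "'a::complete_ultranormed_group"
  using unorm_add_le[of x y] by linarith

lemma unorm_diff_leI:
  "unorm x \<le> r \<Longrightarrow> unorm y \<le> r \<Longrightarrow> unorm (x - y) \<le> r" for x :: "'a::complete_ultranormed_group"
  using unorm_diff_le[of x y] by linarith

lemma unorm_triangle_leI:
  "unorm (x - y) \<le> r \<Longrightarrow> unorm (y - z) \<le> r \<Longrightarrow> unorm (x - z) \<le> r"
  for x :: "'a::complete_ultranormed_group"
  using unorm_add_leI[of "x - y" r "y - z"] by simp

lemma unorm_leI_approx:
  "unorm (x - y) \<le> r \<Longrightarrow> unorm y \<le> r \<Longrightarrow> unorm x \<le> r"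
  for x :: "'a::complete_ultranormed_group"
  using unorm_add_leI[of "x - y" r y] by simp

lemma unorm_sum_le:
  fixes f :: "'i \<Rightarrow> 'a::complete_ultranormed_group"
  assumes "0 \<le> r" and "\<And>i. i \<in> A \<Longrightarrow> unorm (f i) \<le> r"
  shows "unorm (sum f A) \<le> r"
  using assms(2) by (induction A rule: infinite_finite_induct) (auto simp: assms(1) unorm_add_leI)

text \<open>In an ultrametric triangle the two longest sides are equal.\<close>

lemma unorm_add_eq_right:
  fixes x y :: "'a::complete_ultranormed_group"
  assumes "unorm x < unorm y"
  shows "unorm (x + y) = unorm y"
  using unorm_add_le[of x y] unorm_diff_le[of "x + y" x] assms by auto

lemma unorm_one [simp]: "unorm (1::'k::complete_valuation_field) = 1"
proof -
  have "unorm (1::'k) * unorm (1::'k) = unorm (1::'k)"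
    using unorm_mult[of "1::'k" 1] by simp
  then show ?thesis
    by (simp add: unorm_eq_zero)
qed

lemma unorm_inverse: "unorm (inverse c) = inverse (unorm (c::'k::complete_valuation_field))"
proof (cases "c = 0")
  case False
  then have "unorm (inverse c) * unorm c = 1"
    by (metis unorm_mult unorm_one left_inverse)
  with False show ?thesis
    by (simp add: field_simps unorm_eq_zero)
qed simp

lemma in_closure_iff_unorm:
  fixes S :: "'a::complete_ultranormed_group set"
  shows "x \<in> closure S \<longleftrightarrow> (\<forall>\<epsilon>>0. \<exists>y\<in>S. unorm (x - y) \<le> \<epsilon>)"
proof -
  have "(\<exists>y\<in>S. dist y x < \<epsilon>)" if "0 < \<epsilon>" and *: "\<forall>\<epsilon>>0. \<exists>y\<in>S. unorm (x - y) \<le> \<epsilon>" for \<epsilon>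
  proof -
    obtain y where "y \<in> S" "unorm (x - y) \<le> \<epsilon> / 2"
      using * \<open>0 < \<epsilon>\<close> half_gt_zero by blast
    then show ?thesis
      using \<open>0 < \<epsilon>\<close> by (intro bexI[of _ y]) (auto simp: dist_unorm unorm_minus_commute)
  qed
  then show ?thesis
    unfolding closure_approachable by (metis dist_unorm unorm_minus_commute less_imp_le)
qed

section \<open>Orthonormal sets and coordinates\<close>

context banach_kvs
begin

lemma subspace_closure:
  assumes "subspace S"
  shows "subspace (closure S)"
proof (rule subspaceI)
  show "0 \<in> closure S"
    using assms closure_subset subspace_0 by blast
next
  fix x y assume "x \<in> closure S" "y \<in> closure S"
  show "x + y \<in> closure S"
    unfolding in_closure_iff_unorm
  proof (intro allI impI)
    fix \<epsilon> :: real assume "0 < \<epsilon>"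
    then obtain u v where "u \<in> S" "v \<in> S" "unorm (x - u) \<le> \<epsilon>" "unorm (y - v) \<le> \<epsilon>"
      using \<open>x \<in> closure S\<close> \<open>y \<in> closure S\<close> by (meson in_closure_iff_unorm)
    then show "\<exists>w\<in>S. unorm (x + y - w) \<le> \<epsilon>"
      using unorm_add_leI[of "x - u" \<epsilon> "y - v"] assms
      by (intro bexI[of _ "u + v"]) (auto simp: subspace_add algebra_simps)
  qed
next
  fix c x assume "x \<in> closure S"
  show "scl c x \<in> closure S"
    unfolding in_closure_iff_unorm
  proof (intro allI impI)
    fix \<epsilon> :: real assume "0 < \<epsilon>"
    then have "0 < \<epsilon> / (unorm c + 1)"
      by (simp add: add_nonneg_pos)
    then obtain u where "u \<in> S" and u: "unorm (x - u) \<le> \<epsilon> / (unorm c + 1)"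
      using \<open>x \<in> closure S\<close> by (meson in_closure_iff_unorm)
    have "unorm (scl c x - scl c u) = unorm c * unorm (x - u)"
      by (simp add: unorm_scale flip: scale_right_diff_distrib)
    also have "\<dots> \<le> (unorm c + 1) * (\<epsilon> / (unorm c + 1))"
      using u by (intro mult_mono) auto
    also have "\<dots> = \<epsilon>"
      using unorm_ge_zero[of c] by (simp add: add_nonneg_eq_0_iff)
    finally show "\<exists>w\<in>S. unorm (scl c x - w) \<le> \<epsilon>"
      using \<open>u \<in> S\<close> assms subspace_scale by blast
  qed
qed

lemma subspace_closed_lin_span: "subspace (closed_lin_span scl S)"
  by (simp add: closed_lin_span_def subspace_closure)

lemma closed_lin_span_minimal:
  "S \<subseteq> W \<Longrightarrow> subspace W \<Longrightarrow> closed W \<Longrightarrow> closed_lin_span scl S \<subseteq> W"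
  by (simp add: closed_lin_span_def closure_minimal span_minimal)

lemma subset_closed_lin_span: "S \<subseteq> closed_lin_span scl S"
  unfolding closed_lin_span_def using closure_subset span_superset by blast

lemma closed_lin_span_mono: "S \<subseteq> T \<Longrightarrow> closed_lin_span scl S \<subseteq> closed_lin_span scl T"
  by (simp add: closed_lin_span_def closure_mono span_mono)

text \<open>
  Orthonormality is a condition on finite linear combinations: the norm of a combination is the
  largest norm of its coefficients. Taking a single vector with coefficient one gives unit norm.
\<close>

definition orthonormal :: "'v set \<Rightarrow> bool" where
  "orthonormal X \<longleftrightarrow> (\<forall>x\<in>X. unorm x \<le> 1) \<and>
    (\<forall>F c. finite F \<longrightarrow> F \<subseteq> X \<longrightarrow> (\<forall>x\<in>F. unorm (c x) \<le> unorm (\<Sum>x\<in>F. scl (c x) x)))"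

lemma orthonormalD:
  "orthonormal X \<Longrightarrow> x \<in> X \<Longrightarrow> unorm x \<le> 1"
  "orthonormal X \<Longrightarrow> finite F \<Longrightarrow> F \<subseteq> X \<Longrightarrow> x \<in> F \<Longrightarrow>
    unorm (c x) \<le> unorm (\<Sum>x\<in>F. scl (c x) x)"
  by (auto simp: orthonormal_def)

lemma unorm_orthonormal: "orthonormal X \<Longrightarrow> x \<in> X \<Longrightarrow> unorm x = 1"
  using orthonormalD(1)[of X x] orthonormalD(2)[of X "{x}" x "\<lambda>_. 1"] by simp

lemma unorm_lincomb_le:
  assumes "0 \<le> r" and "\<And>x. x \<in> F \<Longrightarrow> unorm (c x) \<le> r" and "\<And>x. x \<in> F \<Longrightarrow> unorm x \<le> 1"
  shows "unorm (\<Sum>x\<in>F. scl (c x) x) \<le> r"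
proof (rule unorm_sum_le[OF \<open>0 \<le> r\<close>])
  fix x assume "x \<in> F"
  then show "unorm (scl (c x) x) \<le> r"
    using mult_mono[of "unorm (c x)" r "unorm x" 1] assms by (simp add: unorm_scale)
qed

lemma orthonormal_independent:
  assumes "orthonormal X"
  shows "independent X"
  unfolding independent_explicit_module
proof (intro allI impI)
  fix F c x assume "finite F" "F \<subseteq> X" "(\<Sum>x\<in>F. scl (c x) x) = 0" "x \<in> F"
  then have "unorm (c x) \<le> 0"
    using orthonormalD(2)[OF assms, of F x c] by simp
  then show "c x = 0"
    using unorm_ge_zero[of "c x"] by (simp add: unorm_eq_zero)
qed

lemma unorm_representation_le:
  assumes "orthonormal X" "u \<in> span X"
  shows "unorm (representation X u x) \<le> unorm u"
proof (cases "representation X u x = 0")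
  case False
  let ?F = "{x. representation X u x \<noteq> 0}"
  have "?F \<subseteq> X"
    using representation_ne_zero by blast
  then have "unorm (representation X u x) \<le> unorm (\<Sum>x\<in>?F. scl (representation X u x) x)"
    using False finite_representation by (intro orthonormalD(2)[OF assms(1)]) auto
  then show ?thesis
    using sum_nonzero_representation_eq[OF orthonormal_independent[OF assms(1)] assms(2)] by simp
qed simp

lemma unorm_le_representation:
  assumes "orthonormal X" "u \<in> span X" "0 \<le> r" "\<And>x. unorm (representation X u x) \<le> r"
  shows "unorm u \<le> r"
proof -
  have "unorm (\<Sum>x | representation X u x \<noteq> 0. scl (representation X u x) x) \<le> r"
    using assms orthonormalD(1)[OF assms(1)] representation_ne_zero
    by (intro unorm_lincomb_le) blast+
  then show ?thesis
    using sum_nonzero_representation_eq[OF orthonormal_independent[OF assms(1)] assms(2)] by simp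
qed

text \<open>
  The coordinates of a vector in the closed span of an orthonormal set are the uniform limits of
  the coordinates of finite combinations approximating it. This description makes linearity
  and the norm formula immediate; agreement with infinite sums is shown afterwards.
\<close>

definition is_coords :: "'v set \<Rightarrow> 'v \<Rightarrow> ('v \<Rightarrow> 'k) \<Rightarrow> bool" where
  "is_coords X v c \<longleftrightarrow> (\<forall>\<epsilon>>0. \<exists>u\<in>span X. unorm (v - u) \<le> \<epsilon> \<and>
     (\<forall>x. unorm (c x - representation X u x) \<le> \<epsilon>))"

lemma is_coordsE:
  assumes "is_coords X v c" "0 < \<epsilon>"
  obtains u where "u \<in> span X" "unorm (v - u) \<le> \<epsilon>"
    "\<And>x. unorm (c x - representation X u x) \<le> \<epsilon>"
  using assms by (auto simp: is_coords_def)

lemma is_coords_add: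
  assumes X: "orthonormal X" and v: "is_coords X v c" and w: "is_coords X w d"
  shows "is_coords X (v + w) (\<lambda>x. c x + d x)"
  unfolding is_coords_def
proof (intro allI impI)
  fix \<epsilon> :: real assume "0 < \<epsilon>"
  obtain s where s: "s \<in> span X" "unorm (v - s) \<le> \<epsilon>" "\<And>x. unorm (c x - representation X s x) \<le> \<epsilon>"
    using is_coordsE[OF v \<open>0 < \<epsilon>\<close>] by blast
  obtain t where t: "t \<in> span X" "unorm (w - t) \<le> \<epsilon>" "\<And>x. unorm (d x - representation X t x) \<le> \<epsilon>"
    using is_coordsE[OF w \<open>0 < \<epsilon>\<close>] by blast
  show "\<exists>u\<in>span X. unorm (v + w - u) \<le> \<epsilon> \<and>
      (\<forall>x. unorm (c x + d x - representation X u x) \<le> \<epsilon>)"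
  proof (intro bexI[of _ "s + t"] conjI allI)
    show "unorm (v + w - (s + t)) \<le> \<epsilon>"
      using unorm_add_leI[OF s(2) t(2)] by (simp add: algebra_simps)
    show "unorm (c x + d x - representation X (s + t) x) \<le> \<epsilon>" for x
      using unorm_add_leI[OF s(3) t(3), of x x] orthonormal_independent[OF X] s(1) t(1)
      by (simp add: representation_add algebra_simps)
  qed (use s t span_add in blast)
qed

lemma is_coords_scale:
  assumes X: "orthonormal X" and v: "is_coords X v c"
  shows "is_coords X (scl a v) (\<lambda>x. a * c x)"
  unfolding is_coords_def
proof (intro allI impI)
  fix \<epsilon> :: real assume "0 < \<epsilon>"
  define \<delta> where "\<delta> = \<epsilon> / (unorm a + 1)"
  have pos: "0 < unorm a + 1"
    by (simp add: add_nonneg_pos)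
  then have "0 < \<delta>"
    using \<open>0 < \<epsilon>\<close> by (simp add: \<delta>_def)
  have bound: "unorm a * r \<le> \<epsilon>" if "r \<le> \<delta>" for r
  proof -
    have "unorm a * r \<le> unorm a * \<delta>"
      using that by (simp add: mult_left_mono)
    also have "\<dots> \<le> (unorm a + 1) * \<delta>"
      using \<open>0 < \<delta>\<close> by simp
    also have "\<dots> = \<epsilon>"
      using pos by (simp add: \<delta>_def)
    finally show ?thesis .
  qed
  obtain s where s: "s \<in> span X" "unorm (v - s) \<le> \<delta>" "\<And>x. unorm (c x - representation X s x) \<le> \<delta>"
    using is_coordsE[OF v \<open>0 < \<delta>\<close>] by blast
  show "\<exists>u\<in>span X. unorm (scl a v - u) \<le> \<epsilon> \<and>
      (\<forall>x. unorm (a * c x - representation X u x) \<le> \<epsilon>)"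
  proof (intro bexI[of _ "scl a s"] conjI allI)
    show "unorm (scl a v - scl a s) \<le> \<epsilon>"
      using bound[OF s(2)] by (simp add: unorm_scale flip: scale_right_diff_distrib)
    show "unorm (a * c x - representation X (scl a s) x) \<le> \<epsilon>" for x
      using bound[OF s(3), of x] orthonormal_independent[OF X] s(1)
      by (simp add: representation_scale unorm_mult flip: right_diff_distrib)
  qed (use s span_scale in blast)
qed

lemma is_coords_norm_le_iff:
  assumes X: "orthonormal X" and v: "is_coords X v c" and "0 \<le> r"
  shows "unorm v \<le> r \<longleftrightarrow> (\<forall>x. unorm (c x) \<le> r)"
proof -
  have "unorm v \<le> r + \<epsilon>" if "\<forall>x. unorm (c x) \<le> r" "0 < \<epsilon>" for \<epsilon>
  proof -
    obtain u where u: "u \<in> span X" "unorm (v - u) \<le> \<epsilon>" "\<And>x. unorm (c x - representation X u x) \<le> \<epsilon>"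
      using is_coordsE[OF v \<open>0 < \<epsilon>\<close>] by blast
    have "unorm (representation X u x) \<le> r + \<epsilon>" for x
      using unorm_leI_approx[of "representation X u x" "c x" "r + \<epsilon>"] u(3)[of x] that \<open>0 \<le> r\<close>
      by (smt (verit) unorm_minus_commute)
    then have "unorm u \<le> r + \<epsilon>"
      using unorm_le_representation[OF X u(1)] that \<open>0 \<le> r\<close> by simp
    then show ?thesis
      using unorm_leI_approx[of v u "r + \<epsilon>"] u(2) \<open>0 \<le> r\<close> by linarith
  qed
  moreover have "unorm (c x) \<le> r + \<epsilon>" if "unorm v \<le> r" "0 < \<epsilon>" for \<epsilon> x
  proof -
    obtain u where u: "u \<in> span X" "unorm (v - u) \<le> \<epsilon>" "\<And>x. unorm (c x - representation X u x) \<le> \<epsilon>"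
      using is_coordsE[OF v \<open>0 < \<epsilon>\<close>] by blast
    have "unorm u \<le> r + \<epsilon>"
      using unorm_leI_approx[of u v "r + \<epsilon>"] u(2) that \<open>0 \<le> r\<close> by (smt (verit) unorm_minus_commute)
    then have "unorm (representation X u x) \<le> r + \<epsilon>"
      using unorm_representation_le[OF X u(1), of x] by linarith
    then show ?thesis
      using unorm_leI_approx[of "c x" "representation X u x" "r + \<epsilon>"] u(3)[of x] \<open>0 \<le> r\<close>
      by linarith
  qed
  ultimately show ?thesis
    by (meson field_le_epsilon)
qed

lemma is_coords_unique:
  assumes X: "orthonormal X" and c: "is_coords X v c" and d: "is_coords X v d"
  shows "c = d"
proof
  fix x
  have "is_coords X (v + scl (- 1) v) (\<lambda>x. c x + - 1 * d x)"
    by (intro is_coords_add is_coords_scale X c d)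
  then have "is_coords X 0 (\<lambda>x. c x - d x)"
    by simp
  then have "unorm (c x - d x) \<le> 0"
    using is_coords_norm_le_iff[OF X, of 0 "\<lambda>x. c x - d x" 0] by simp
  then show "c x = d x"
    using unorm_ge_zero[of "c x - d x"] by (simp add: unorm_eq_zero)
qed

lemma is_coords_eq_zero:
  assumes v: "is_coords X v c" and "x \<notin> X"
  shows "c x = 0"
proof (rule ccontr)
  assume "c x \<noteq> 0"
  then have pos: "0 < unorm (c x)"
    using unorm_ge_zero[of "c x"] by (simp add: less_le unorm_eq_zero)
  then obtain u where "u \<in> span X" "unorm (c x - representation X u x) \<le> unorm (c x) / 2"
    using is_coordsE[OF v, of "unorm (c x) / 2"] by (metis half_gt_zero)
  moreover have "representation X u x = 0"
    using representation_ne_zero \<open>x \<notin> X\<close> by blast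
  ultimately show False
    using pos by simp
qed

lemma is_coords_null:
  assumes v: "is_coords X v c" and "0 < \<epsilon>"
  shows "finite {x. \<epsilon> \<le> unorm (c x)}"
proof -
  obtain u where "u \<in> span X" and u: "\<And>x. unorm (c x - representation X u x) \<le> \<epsilon> / 2"
    using is_coordsE[OF v half_gt_zero[OF \<open>0 < \<epsilon>\<close>]] by blast
  have "representation X u x \<noteq> 0" if "\<epsilon> \<le> unorm (c x)" for x
    using u[of x] that \<open>0 < \<epsilon>\<close> by auto
  then have "{x. \<epsilon> \<le> unorm (c x)} \<subseteq> {x. representation X u x \<noteq> 0}"
    by blast
  then show ?thesis
    using finite_subset finite_representation by blast
qed

lemma is_coords_exists:
  assumes X: "orthonormal X" and v: "v \<in> closure (span X)"
  shows "\<exists>c. is_coords X v c"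
proof -
  define \<delta> where "\<delta> n = 1 / real (Suc n)" for n
  have \<delta>: "0 < \<delta> n" "m \<le> n \<Longrightarrow> \<delta> n \<le> \<delta> m" for m n
    by (auto simp: \<delta>_def field_simps)
  have "\<exists>u. u \<in> span X \<and> unorm (v - u) \<le> \<delta> n" for n
    using v \<delta>(1)[of n] by (meson in_closure_iff_unorm)
  then obtain u where u: "\<And>n. u n \<in> span X" "\<And>n. unorm (v - u n) \<le> \<delta> n"
    by metis
  let ?R = "\<lambda>n. representation X (u n)"
  have diff: "unorm (?R m x - ?R n x) \<le> \<delta> m" if "m \<le> n" for m n x
  proof -
    have "unorm (u m - u n) \<le> \<delta> m"
      using unorm_triangle_leI[of "u m" v "\<delta> m" "u n"] u(2)[of m] u(2)[of n] \<delta>(2)[OF that]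
      by (simp add: unorm_minus_commute)
    moreover have "unorm (?R m x - ?R n x) \<le> unorm (u m - u n)"
      using unorm_representation_le[OF X span_diff[OF u(1) u(1)], of m n x]
      by (simp add: representation_diff[OF orthonormal_independent[OF X] u(1) u(1)])
    ultimately show ?thesis
      by linarith
  qed
  have small: "\<exists>n. \<delta> n < \<epsilon>" if "0 < \<epsilon>" for \<epsilon>
    using that reals_Archimedean[of \<epsilon>] by (auto simp: \<delta>_def inverse_eq_divide)
  have "Cauchy (\<lambda>n. ?R n x)" for x
    unfolding Cauchy_altdef
  proof (intro allI impI)
    fix \<epsilon> :: real assume "0 < \<epsilon>"
    then obtain N where "\<delta> N < \<epsilon>"
      using small by blast
    then have "dist (?R m x) (?R n x) < \<epsilon>" if "N \<le> m" "m < n" for m n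
      using diff[of m n x] that \<delta>(2)[of N m] by (simp add: dist_unorm)
    then show "\<exists>M. \<forall>m\<ge>M. \<forall>n>m. dist (?R m x) (?R n x) < \<epsilon>"
      by blast
  qed
  then have "\<exists>l. (\<lambda>n. ?R n x) \<longlonglongrightarrow> l" for x
    using Cauchy_convergent convergent_def by blast
  then obtain c where c: "\<And>x. (\<lambda>n. ?R n x) \<longlonglongrightarrow> c x"
    by metis
  have lim: "unorm (c x - ?R m x) \<le> \<delta> m" for m x
  proof -
    obtain N where N: "\<And>n. N \<le> n \<Longrightarrow> dist (?R n x) (c x) < \<delta> m"
      using c[of x] \<delta>(1)[of m] unfolding lim_sequentially by blast
    have "unorm (c x - ?R (max m N) x) \<le> \<delta> m"
      using N[of "max m N"] by (simp add: dist_unorm unorm_minus_commute)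
    moreover have "unorm (?R (max m N) x - ?R m x) \<le> \<delta> m"
      using diff[of m "max m N" x] by (simp add: unorm_minus_commute)
    ultimately show ?thesis
      by (rule unorm_triangle_leI)
  qed
  have "is_coords X v c"
    unfolding is_coords_def
  proof (intro allI impI)
    fix \<epsilon> :: real assume "0 < \<epsilon>"
    then obtain n where "\<delta> n < \<epsilon>"
      using small by blast
    with u[of n] lim[of _ n]
    show "\<exists>u\<in>span X. unorm (v - u) \<le> \<epsilon> \<and> (\<forall>x. unorm (c x - representation X u x) \<le> \<epsilon>)"
      by (intro bexI[of _ "u n"]) (auto intro: order_trans less_imp_le)
  qed
  then show ?thesis
    by blast
qed

lemma is_coords_in_closure: "is_coords X v c \<Longrightarrow> v \<in> closure (span X)"
  unfolding is_coords_def in_closure_iff_unorm by blast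

lemma is_coords_has_sum:
  assumes X: "orthonormal X" and v: "is_coords X v c"
  shows "((\<lambda>x. scl (c x) x) has_sum v) X"
  unfolding has_sum_def tendsto_iff eventually_finite_subsets_at_top
proof (intro allI impI)
  fix \<epsilon> :: real assume "0 < \<epsilon>"
  then obtain u where u: "u \<in> span X" "unorm (v - u) \<le> \<epsilon> / 2"
      "\<And>x. unorm (c x - representation X u x) \<le> \<epsilon> / 2"
    using is_coordsE[OF v half_gt_zero[OF \<open>0 < \<epsilon>\<close>]] by blast
  let ?F = "{x. representation X u x \<noteq> 0}"
  have "dist (\<Sum>x\<in>G. scl (c x) x) v < \<epsilon>" if G: "finite G" "?F \<subseteq> G" "G \<subseteq> X" for G
  proof -
    have eq: "(\<Sum>x\<in>G. scl (representation X u x) x) = u"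
      using sum_nonzero_representation_eq[OF orthonormal_independent[OF X] u(1)]
        sum.mono_neutral_left[of G ?F "\<lambda>x. scl (representation X u x) x"] G by auto
    have "unorm (\<Sum>x\<in>G. scl (c x - representation X u x) x) \<le> \<epsilon> / 2"
      using u(3) \<open>0 < \<epsilon>\<close> G(3) orthonormalD(1)[OF X] by (intro unorm_lincomb_le) auto
    then have "unorm ((\<Sum>x\<in>G. scl (c x) x) - u) \<le> \<epsilon> / 2"
      by (simp add: scale_left_diff_distrib sum_subtractf eq)
    then have "unorm ((\<Sum>x\<in>G. scl (c x) x) - v) \<le> \<epsilon> / 2"
      using u(2) unorm_triangle_leI by (metis unorm_minus_commute)
    then show ?thesis
      using \<open>0 < \<epsilon>\<close> by (simp add: dist_unorm)
  qed
  moreover have "finite ?F" "?F \<subseteq> X"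
    using finite_representation representation_ne_zero by blast+
  ultimately show "\<exists>F. finite F \<and> F \<subseteq> X \<and>
      (\<forall>G. finite G \<and> F \<subseteq> G \<and> G \<subseteq> X \<longrightarrow> dist (\<Sum>x\<in>G. scl (c x) x) v < \<epsilon>)"
    by blast
qed

lemma is_coords_C0: "is_coords X v c \<Longrightarrow> c \<in> C0 X"
  unfolding C0_def using is_coords_null finite_subset[of "{x \<in> X. _ x}" "{x. _ x}"]
  by (auto intro!: rev_finite_subset[OF is_coords_null])

lemma is_coords_C0_norm:
  assumes X: "orthonormal X" and v: "is_coords X v c"
  shows "unorm v = C0_norm X c"
proof (cases "X = {}")
  case True
  then have "v = 0"
    using is_coords_in_closure[OF v] by simp
  with True show ?thesis
    by (simp add: C0_norm_def)
next
  case False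
  have le: "unorm (c x) \<le> unorm v" for x
    using is_coords_norm_le_iff[OF X v, of "unorm v"] by simp
  have "unorm v \<le> (SUP x\<in>X. unorm (c x))"
  proof -
    have bdd: "bdd_above ((\<lambda>x. unorm (c x)) ` X)"
      using le by (auto simp: bdd_above_def)
    obtain x0 where "x0 \<in> X"
      using False by blast
    then have "0 \<le> (SUP x\<in>X. unorm (c x))"
      using cSUP_upper2[OF bdd] by simp
    moreover have "unorm (c x) \<le> (SUP x\<in>X. unorm (c x))" for x
      using cSUP_upper[OF _ bdd] is_coords_eq_zero[OF v] calculation by (cases "x \<in> X") auto
    ultimately show ?thesis
      using is_coords_norm_le_iff[OF X v] by blast
  qed
  moreover have "(SUP x\<in>X. unorm (c x)) \<le> unorm v"
    using False le by (rule cSUP_least)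
  ultimately show ?thesis
    using False by (simp add: C0_norm_def)
qed

text \<open>Completeness of the space enters here: every family in \<open>C\<^sub>0\<close> is summable.\<close>

lemma C0_is_coords:
  assumes X: "orthonormal X" and c: "c \<in> C0 X"
  shows "\<exists>v. is_coords X v (\<lambda>x. if x \<in> X then c x else 0)"
proof -
  define \<delta> where "\<delta> n = 1 / real (Suc n)" for n
  have \<delta>: "0 < \<delta> n" "m \<le> n \<Longrightarrow> \<delta> n \<le> \<delta> m" for m n
    by (auto simp: \<delta>_def field_simps)
  have small: "\<exists>n. \<delta> n < \<epsilon>" if "0 < \<epsilon>" for \<epsilon>
    using that reals_Archimedean[of \<epsilon>] by (auto simp: \<delta>_def inverse_eq_divide)
  define F where "F n = {x \<in> X. \<delta> n \<le> unorm (c x)}" for n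
  define u where "u n = (\<Sum>x\<in>F n. scl (c x) x)" for n
  have F: "finite (F n)" "F n \<subseteq> X" for n
    using c \<delta>(1) by (auto simp: F_def C0_def)
  have u: "u n \<in> span X" for n
    unfolding u_def using F(2)[of n] by (intro span_sum span_scale span_base) auto
  have diff: "unorm (u n - u m) \<le> \<delta> m" if "m \<le> n" for m n
  proof -
    have "F m \<subseteq> F n"
      using \<delta>(2)[OF that] by (auto simp: F_def)
    then have "u n - u m = (\<Sum>x\<in>F n - F m. scl (c x) x)"
      using F(1)[of n] by (simp add: u_def sum_diff)
    moreover have "unorm (\<Sum>x\<in>F n - F m. scl (c x) x) \<le> \<delta> m"
      using \<delta>(1)[of m] F(2)[of n] orthonormalD(1)[OF X]
      by (intro unorm_lincomb_le) (auto simp: F_def)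
    ultimately show ?thesis
      by simp
  qed
  have "Cauchy u"
    unfolding Cauchy_altdef
  proof (intro allI impI)
    fix \<epsilon> :: real assume "0 < \<epsilon>"
    then obtain N where "\<delta> N < \<epsilon>"
      using small by blast
    then have "dist (u m) (u n) < \<epsilon>" if "N \<le> m" "m < n" for m n
      using diff[of m n] that \<delta>(2)[of N m] by (simp add: dist_unorm unorm_minus_commute)
    then show "\<exists>M. \<forall>m\<ge>M. \<forall>n>m. dist (u m) (u n) < \<epsilon>"
      by blast
  qed
  then obtain v where v: "u \<longlonglongrightarrow> v"
    using Cauchy_convergent convergent_def by blast
  have lim: "unorm (v - u m) \<le> \<delta> m" for m
  proof -
    obtain N where N: "\<And>n. N \<le> n \<Longrightarrow> dist (u n) v < \<delta> m"
      using v \<delta>(1)[of m] unfolding lim_sequentially by blast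
    have "unorm (v - u (max m N)) \<le> \<delta> m"
      using N[of "max m N"] by (simp add: dist_unorm unorm_minus_commute)
    moreover have "unorm (u (max m N) - u m) \<le> \<delta> m"
      using diff[of m "max m N"] by simp
    ultimately show ?thesis
      by (rule unorm_triangle_leI)
  qed
  have rep: "representation X (u n) = (\<lambda>x. if x \<in> F n then c x else 0)" for n
  proof (rule representation_eqI[OF orthonormal_independent[OF X] u])
    have ss: "{x. (if x \<in> F n then c x else 0) \<noteq> 0} \<subseteq> F n"
      by auto
    then show "finite {x. (if x \<in> F n then c x else 0) \<noteq> 0}"
      using F(1) finite_subset by blast
    show "(if x \<in> F n then c x else 0) \<noteq> 0 \<Longrightarrow> x \<in> X" for x
      using F(2)[of n] by (auto split: if_splits)
    show "(\<Sum>x | (if x \<in> F n then c x else 0) \<noteq> 0. scl (if x \<in> F n then c x else 0) x) = u n"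
      unfolding u_def using F(1)[of n] ss by (intro sum.mono_neutral_cong_left) auto
  qed
  have "is_coords X v (\<lambda>x. if x \<in> X then c x else 0)"
    unfolding is_coords_def
  proof (intro allI impI)
    fix \<epsilon> :: real assume "0 < \<epsilon>"
    then obtain n where n: "\<delta> n < \<epsilon>"
      using small by blast
    show "\<exists>u\<in>span X. unorm (v - u) \<le> \<epsilon> \<and>
        (\<forall>x. unorm ((if x \<in> X then c x else 0) - representation X u x) \<le> \<epsilon>)"
    proof (intro bexI[of _ "u n"] conjI allI)
      show "unorm (v - u n) \<le> \<epsilon>"
        using lim[of n] n by simp
      show "unorm ((if x \<in> X then c x else 0) - representation X (u n) x) \<le> \<epsilon>" for x
        using n F(2)[of n] \<open>0 < \<epsilon>\<close> by (auto simp: rep F_def)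
    qed (rule u)
  qed
  then show ?thesis ..
qed

lemma orthonormal_schauder_basis_iff:
  "orthonormal_schauder_basis scl W X \<longleftrightarrow> X \<subseteq> W \<and> orthonormal X \<and> W \<subseteq> closure (span X)"
proof (intro iffI conjI)
  have sum_C0: "\<exists>v. is_coords X v (\<lambda>x. if x \<in> X then c x else 0) \<and> (\<Sum>\<^sub>\<infinity>x\<in>X. scl (c x) x) = v"
    if X: "orthonormal X" and c: "c \<in> C0 X" for c
  proof -
    obtain v where v: "is_coords X v (\<lambda>x. if x \<in> X then c x else 0)"
      using C0_is_coords[OF X c] by blast
    have "(\<Sum>\<^sub>\<infinity>x\<in>X. scl (c x) x) = (\<Sum>\<^sub>\<infinity>x\<in>X. scl (if x \<in> X then c x else 0) x)"
      by (rule infsum_cong) simp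
    also have "\<dots> = v"
      by (rule infsumI[OF is_coords_has_sum[OF X v]])
    finally show ?thesis
      using v by blast
  qed
  {
    assume B: "orthonormal_schauder_basis scl W X"
    show "X \<subseteq> W"
      using B by (simp add: orthonormal_schauder_basis_def)
    show X: "orthonormal X"
      unfolding orthonormal_def
    proof (intro conjI ballI allI impI)
      show "unorm x \<le> 1" if "x \<in> X" for x
        using B that by (simp add: orthonormal_schauder_basis_def)
    next
      fix F and c :: "'v \<Rightarrow> 'k" and x assume F: "finite F" "F \<subseteq> X" "x \<in> F"
      define d where "d x = (if x \<in> F then c x else 0)" for x
      have d: "d \<in> C0 X"
        unfolding C0_def using F(1) by (auto simp: d_def intro: rev_finite_subset)
      have "(\<Sum>x\<in>F. scl (c x) x) = (\<Sum>\<^sub>\<infinity>x\<in>X. scl (d x) x)"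
      proof -
        have "(\<Sum>\<^sub>\<infinity>x\<in>X. scl (d x) x) = (\<Sum>\<^sub>\<infinity>x\<in>F. scl (c x) x)"
          using F(2) by (intro infsum_cong_neutral) (auto simp: d_def)
        then show ?thesis
          using F(1) by simp
      qed
      then have "unorm (\<Sum>x\<in>F. scl (c x) x) = C0_norm X d"
        using B d by (simp add: orthonormal_schauder_basis_def)
      also have "\<dots> = (SUP x\<in>X. unorm (d x))"
        using F by (auto simp: C0_norm_def)
      also have "\<dots> \<ge> unorm (d x)"
      proof (rule cSUP_upper)
        have "(\<lambda>x. unorm (d x)) ` X \<subseteq> insert 0 ((\<lambda>x. unorm (c x)) ` F)"
          by (auto simp: d_def)
        then show "bdd_above ((\<lambda>x. unorm (d x)) ` X)"
          using F(1) by (meson bdd_above_finite finite_imageI finite_insert finite_subset)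
      qed (use F in auto)
      finally show "unorm (c x) \<le> unorm (\<Sum>x\<in>F. scl (c x) x)"
        using F(3) by (simp add: d_def)
    qed
    show "W \<subseteq> closure (span X)"
    proof
      fix v assume "v \<in> W"
      then obtain c where "c \<in> C0 X" "v = (\<Sum>\<^sub>\<infinity>x\<in>X. scl (c x) x)"
        using B by (auto simp: orthonormal_schauder_basis_def)
      then show "v \<in> closure (span X)"
        using sum_C0[OF X] is_coords_in_closure by blast
    qed
  }
  assume A: "X \<subseteq> W \<and> orthonormal X \<and> W \<subseteq> closure (span X)"
  then have X: "orthonormal X"
    by blast
  show "orthonormal_schauder_basis scl W X"
    unfolding orthonormal_schauder_basis_def
  proof (intro conjI ballI)
    fix c :: "'v \<Rightarrow> 'k" assume "c \<in> C0 X"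
    then obtain v where v: "is_coords X v (\<lambda>x. if x \<in> X then c x else 0)"
        "(\<Sum>\<^sub>\<infinity>x\<in>X. scl (c x) x) = v"
      using sum_C0[OF X] by blast
    then show "unorm (\<Sum>\<^sub>\<infinity>x\<in>X. scl (c x) x) = C0_norm X c"
      using is_coords_C0_norm[OF X v(1)] by (simp add: C0_norm_def cong: SUP_cong)
  next
    fix v assume "v \<in> W"
    then obtain c where c: "is_coords X v c"
      using A is_coords_exists by blast
    then show "\<exists>c\<in>C0 X. v = (\<Sum>\<^sub>\<infinity>x\<in>X. scl (c x) x)"
      using infsumI[OF is_coords_has_sum[OF X c]] is_coords_C0 by metis
  qed (use A unorm_orthonormal in auto)
qed

end

section \<open>Countability\<close>

lemma countable_cofinal_subset_real:
  fixes R :: "real set"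
  obtains C where "C \<subseteq> R" "countable C" "\<forall>x\<in>R. \<exists>y\<in>C. x \<le> y"
proof -
  obtain T where T: "countable T" "T \<subseteq> R" "R \<subseteq> closure T"
    using separable by blast
  show ?thesis
  proof (cases "\<exists>m\<in>R. \<forall>x\<in>R. x \<le> m")
    case True
    then obtain m where "m \<in> R" "\<forall>x\<in>R. x \<le> m"
      by blast
    then show ?thesis
      by (intro that[of "{m}"]) auto
  next
    case False
    have "\<exists>y\<in>T. x \<le> y" if "x \<in> R" for x
    proof -
      obtain z where "z \<in> R" "x < z"
        using False \<open>x \<in> R\<close> by force
      then obtain y where "y \<in> T" "dist y z < z - x"
        using T(3) closure_approachable[of z T] by (metis diff_gt_0_iff_gt subsetD)
      then show ?thesis
        by (intro bexI[of _ y]) (auto simp: dist_real_def)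
    qed
    with T show ?thesis
      by (intro that[of T]) auto
  qed
qed

lemma finite_subset_UN_incseq:
  fixes A :: "nat \<Rightarrow> 'a set"
  assumes "finite F" "F \<subseteq> (\<Union>n. A n)" and mono: "\<And>m n. m \<le> n \<Longrightarrow> A m \<subseteq> A n"
  shows "\<exists>n. F \<subseteq> A n"
  using assms(1,2)
proof (induction F rule: finite_induct)
  case (insert x F)
  then obtain m n where "x \<in> A m" "F \<subseteq> A n"
    by auto
  then have "insert x F \<subseteq> A (max m n)"
    using mono[of m "max m n"] mono[of n "max m n"] by auto
  then show ?case ..
qed simp

lemma countable_closure_under_finite_subsets:
  fixes h :: "'a set \<Rightarrow> 'a set"
  assumes h: "\<And>F. finite F \<Longrightarrow> countable (h F)" and B: "countable B"
  shows "\<exists>A. B \<subseteq> A \<and> countable A \<and> (\<forall>F. finite F \<longrightarrow> F \<subseteq> A \<longrightarrow> h F \<subseteq> A)"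
proof -
  define N where "N C = C \<union> (\<Union>F\<in>{F. finite F \<and> F \<subseteq> C}. h F)" for C
  define A where "A n = (N ^^ n) B" for n
  have A_Suc: "A (Suc n) = N (A n)" for n
    by (simp add: A_def)
  have mono: "A m \<subseteq> A n" if "m \<le> n" for m n
    using that by (rule lift_Suc_mono_le[rotated]) (auto simp: A_Suc N_def)
  have count: "countable (A n)" for n
  proof (induction n)
    case 0
    show ?case
      using B by (simp add: A_def)
  next
    case (Suc n)
    then have "countable {F. finite F \<and> F \<subseteq> A n}"
      by (rule countable_Collect_finite_subset)
    then have "countable (\<Union>F\<in>{F. finite F \<and> F \<subseteq> A n}. h F)"
      using h by (intro countable_UN) auto
    with Suc show ?case
      by (simp add: A_Suc N_def)
  qed
  show ?thesis
  proof (intro exI[of _ "\<Union>n. A n"] conjI allI impI)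
    show "B \<subseteq> (\<Union>n. A n)"
      using UN_upper[of 0 UNIV A] by (simp add: A_def)
    show "countable (\<Union>n. A n)"
      using count by simp
    fix F assume F: "finite F" "F \<subseteq> (\<Union>n. A n)"
    then obtain n where "F \<subseteq> A n"
      using finite_subset_UN_incseq[OF F(1,2) mono] by blast
    then have "h F \<subseteq> A (Suc n)"
      using F(1) by (auto simp: A_Suc N_def)
    then show "h F \<subseteq> (\<Union>n. A n)"
      by blast
  qed
qed

section \<open>Good sets of coordinates\<close>

text \<open>
  A subspace \<open>D\<close> embedded isometrically and linearly by \<open>\<phi>\<close> into \<open>C\<^sub>0('e, k)\<close>. Neither \<open>D\<close> nor the
  image is required to be closed.
\<close>

locale null_coordinates = banach_kvs scl
  for scl :: "'k::complete_valuation_field \<Rightarrow> 'v::complete_ultranormed_group \<Rightarrow> 'v" +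
  fixes D :: "'v set" and \<phi> :: "'v \<Rightarrow> 'e \<Rightarrow> 'k"
  assumes subspace_D: "subspace D"
    and coord_add: "u \<in> D \<Longrightarrow> v \<in> D \<Longrightarrow> \<phi> (u + v) e = \<phi> u e + \<phi> v e"
    and coord_scale: "v \<in> D \<Longrightarrow> \<phi> (scl a v) e = a * \<phi> v e"
    and coord_null: "v \<in> D \<Longrightarrow> 0 < \<epsilon> \<Longrightarrow> finite {e. \<epsilon> \<le> unorm (\<phi> v e)}"
    and norm_le_iff: "v \<in> D \<Longrightarrow> 0 \<le> r \<Longrightarrow> unorm v \<le> r \<longleftrightarrow> (\<forall>e. unorm (\<phi> v e) \<le> r)"
begin

lemma D_closed [intro]:
  "0 \<in> D" "u \<in> D \<Longrightarrow> v \<in> D \<Longrightarrow> u + v \<in> D" "u \<in> D \<Longrightarrow> v \<in> D \<Longrightarrow> u - v \<in> D"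
  "v \<in> D \<Longrightarrow> scl a v \<in> D" "(\<And>i. i \<in> I \<Longrightarrow> f i \<in> D) \<Longrightarrow> sum f I \<in> D"
  using subspace_D
  by (auto simp: subspace_0 subspace_add subspace_diff subspace_scale subspace_sum)

lemma coord_zero [simp]: "\<phi> 0 e = 0"
  using coord_scale[of 0 0 e] D_closed(1) by simp

lemma coord_diff: "u \<in> D \<Longrightarrow> v \<in> D \<Longrightarrow> \<phi> (u - v) e = \<phi> u e - \<phi> v e"
  using coord_add[of "u - v" v e] D_closed(3) by (simp add: algebra_simps)

lemma unorm_coord_le: "v \<in> D \<Longrightarrow> unorm (\<phi> v e) \<le> unorm v"
  using norm_le_iff[of v "unorm v"] by simp

lemma span_subset_D: "Y \<subseteq> D \<Longrightarrow> u \<in> span Y \<Longrightarrow> u \<in> D"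
  using span_minimal[OF _ subspace_D] by blast

lemma countable_support:
  assumes "v \<in> D"
  shows "countable {e. \<phi> v e \<noteq> 0}"
proof -
  have "{e. \<phi> v e \<noteq> 0} \<subseteq> (\<Union>n. {e. 1 / real (Suc n) \<le> unorm (\<phi> v e)})"
  proof
    fix e assume "e \<in> {e. \<phi> v e \<noteq> 0}"
    then have "0 < unorm (\<phi> v e)"
      using unorm_ge_zero[of "\<phi> v e"] by (simp add: less_le unorm_eq_zero)
    then obtain n where "inverse (real (Suc n)) < unorm (\<phi> v e)"
      using reals_Archimedean by blast
    then show "e \<in> (\<Union>n. {e. 1 / real (Suc n) \<le> unorm (\<phi> v e)})"
      by (auto simp: inverse_eq_divide intro: less_imp_le)
  qed
  moreover have "countable {e. 1 / real (Suc n) \<le> unorm (\<phi> v e)}" for n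
    using coord_null[OF assms, of "1 / real (Suc n)"] by (simp add: uncountable_infinite countable_finite)
  ultimately show ?thesis
    by (meson countable_UN countableI_type countable_subset)
qed

lemma coord_max:
  assumes "v \<in> D" "e \<in> B" "\<phi> v e \<noteq> 0"
  obtains m where "m \<in> B" "\<phi> v m \<noteq> 0" "\<And>e. e \<in> B \<Longrightarrow> unorm (\<phi> v e) \<le> unorm (\<phi> v m)"
proof -
  let ?c = "unorm (\<phi> v e)"
  have pos: "0 < ?c"
    using assms(3) unorm_ge_zero[of "\<phi> v e"] by (simp add: less_le unorm_eq_zero)
  let ?S = "{e' \<in> B. ?c \<le> unorm (\<phi> v e')}"
  have fin: "finite ?S"
    by (rule rev_finite_subset[OF coord_null[OF assms(1) pos]]) blast
  define M where "M = Max ((\<lambda>e. unorm (\<phi> v e)) ` ?S)"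
  have "M \<in> (\<lambda>e. unorm (\<phi> v e)) ` ?S"
    unfolding M_def using fin assms(2) by (intro Max_in) auto
  then obtain m where "m \<in> ?S" "M = unorm (\<phi> v m)"
    by blast
  moreover have "unorm (\<phi> v e') \<le> M" if "e' \<in> ?S" for e'
    unfolding M_def using fin that by (intro Max_ge) auto
  ultimately have m: "m \<in> ?S" "\<And>e'. e' \<in> ?S \<Longrightarrow> unorm (\<phi> v e') \<le> unorm (\<phi> v m)"
    by simp_all
  show ?thesis
  proof (rule that[of m])
    show "\<phi> v m \<noteq> 0"
      using m(1) pos by auto
    show "unorm (\<phi> v e') \<le> unorm (\<phi> v m)" if "e' \<in> B" for e'
      using that m(2)[of e'] m(1) by (cases "?c \<le> unorm (\<phi> v e')") auto
  qed (use m in simp)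
qed

definition supported :: "'e set \<Rightarrow> 'v set" where
  "supported A = {v \<in> D. \<forall>e. e \<notin> A \<longrightarrow> \<phi> v e = 0}"

lemma subspace_supported: "subspace (supported A)"
  by (rule subspaceI) (auto simp: supported_def coord_add coord_scale)

lemma supported_mono: "A \<subseteq> B \<Longrightarrow> supported A \<subseteq> supported B"
  by (auto simp: supported_def)

text \<open>
  For a good set \<open>A\<close> of indices, deleting the coordinates in \<open>A\<close> embeds the quotient of \<open>D\<close> by the
  vectors supported in \<open>A\<close> isometrically, and the quotient norm is attained.
\<close>

definition good :: "'e set \<Rightarrow> bool" where
  "good A \<longleftrightarrow> (\<forall>d\<in>D. \<forall>r\<ge>0. (\<forall>e. e \<notin> A \<longrightarrow> unorm (\<phi> d e) \<le> r) \<longrightarrow>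
     (\<exists>m\<in>supported A. unorm (d - m) \<le> r))"

lemma goodE:
  assumes "good A" "d \<in> D" "0 \<le> r" "\<And>e. e \<notin> A \<Longrightarrow> unorm (\<phi> d e) \<le> r"
  obtains m where "m \<in> supported A" "unorm (d - m) \<le> r"
  using assms unfolding good_def by blast

lemma good_empty: "good {}"
  unfolding good_def
proof (intro ballI allI impI)
  fix d and r :: real assume "d \<in> D" "0 \<le> r" "\<forall>e. e \<notin> {} \<longrightarrow> unorm (\<phi> d e) \<le> r"
  then show "\<exists>m\<in>supported {}. unorm (d - m) \<le> r"
    using norm_le_iff subspace_0[OF subspace_supported] by (intro bexI[of _ 0]) auto
qed

text \<open>
  Goodness need only be tested on the exact bound: the largest norm of a coordinate outside \<open>A\<close>
  is attained when it is not zero.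
\<close>

lemma goodI:
  assumes "\<And>d p. d \<in> D \<Longrightarrow> p \<notin> A \<Longrightarrow> \<phi> d p \<noteq> 0 \<Longrightarrow>
      (\<And>e. e \<notin> A \<Longrightarrow> unorm (\<phi> d e) \<le> unorm (\<phi> d p)) \<Longrightarrow>
      \<exists>m\<in>supported A. unorm (d - m) \<le> unorm (\<phi> d p)"
  shows "good A"
  unfolding good_def
proof (intro ballI allI impI)
  fix d and r :: real assume d: "d \<in> D" and r: "0 \<le> r" "\<forall>e. e \<notin> A \<longrightarrow> unorm (\<phi> d e) \<le> r"
  show "\<exists>m\<in>supported A. unorm (d - m) \<le> r"
  proof (cases "d \<in> supported A")
    case True
    then show ?thesis
      using \<open>0 \<le> r\<close> by (intro bexI[of _ d]) auto
  next
    case False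
    then obtain e where "e \<in> - A" "\<phi> d e \<noteq> 0"
      using d by (auto simp: supported_def)
    then obtain p where p: "p \<in> - A" "\<phi> d p \<noteq> 0"
        "\<And>e. e \<in> - A \<Longrightarrow> unorm (\<phi> d e) \<le> unorm (\<phi> d p)"
      using coord_max[OF d] by metis
    then obtain m where "m \<in> supported A" "unorm (d - m) \<le> unorm (\<phi> d p)"
      using assms[OF d, of p] by auto
    then show ?thesis
      using p(1) r(2) by (intro bexI[of _ m]) auto
  qed
qed

text \<open>
  Submodules of \<open>k\<^sup>n\<close> over the valuation ring are countably generated, because those of \<open>k\<close> are: a
  countable set of elements with cofinal norms generates. The induction on \<open>n\<close> is carried out in
  \<open>D\<close>: \<open>F\<close> is the set of the \<open>n\<close> coordinates, and the submodule is the image of \<open>J\<close>.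
\<close>

lemma countable_generators:
  assumes "finite F" and "J \<subseteq> D" and "0 \<in> J"
    and "\<And>u v. u \<in> J \<Longrightarrow> v \<in> J \<Longrightarrow> u + v \<in> J"
    and "\<And>a u. unorm a \<le> 1 \<Longrightarrow> u \<in> J \<Longrightarrow> scl a u \<in> J"
  shows "\<exists>G\<subseteq>J. countable G \<and> (\<forall>d\<in>J. \<exists>m\<in>J \<inter> span G. \<forall>e\<in>F. \<phi> m e = \<phi> d e)"
  using assms
proof (induction F arbitrary: J rule: finite_induct)
  case empty
  then show ?case
    by (intro exI[of _ "{}"]) auto
next
  case (insert e F)
  note J = insert.prems
  have J_diff: "u - v \<in> J" if "u \<in> J" "v \<in> J" for u v
    using J(3)[OF that(1) J(4)[OF _ that(2), of "- 1"]] by simp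
  define J0 where "J0 = {d \<in> J. \<phi> d e = 0}"
  have "J0 \<subseteq> D" "0 \<in> J0"
    using J(1,2) by (auto simp: J0_def)
  moreover have "u + v \<in> J0" if "u \<in> J0" "v \<in> J0" for u v
    using that J(1) J(3)[of u v] by (auto simp: J0_def coord_add subset_iff)
  moreover have "scl a u \<in> J0" if "unorm a \<le> 1" "u \<in> J0" for a u
    using that J(1) J(4)[of a u] by (auto simp: J0_def coord_scale subset_iff)
  ultimately obtain G where G: "G \<subseteq> J0" "countable G"
      "\<forall>d\<in>J0. \<exists>m\<in>J0 \<inter> span G. \<forall>e\<in>F. \<phi> m e = \<phi> d e"
    using insert.IH[of J0] by blast
  have G': "\<exists>m\<in>J \<inter> span G. \<phi> m e = 0 \<and> (\<forall>e\<in>F. \<phi> m e = \<phi> d e)" if "d \<in> J" "\<phi> d e = 0" for d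
  proof -
    have "d \<in> J0"
      using that by (simp add: J0_def)
    then obtain m where "m \<in> J0" "m \<in> span G" "\<forall>e\<in>F. \<phi> m e = \<phi> d e"
      using G(3) by blast
    then show ?thesis
      by (intro bexI[of _ m]) (auto simp: J0_def)
  qed
  obtain C where C: "C \<subseteq> (\<lambda>d. unorm (\<phi> d e)) ` J" "countable C"
      "\<forall>x\<in>(\<lambda>d. unorm (\<phi> d e)) ` J. \<exists>y\<in>C. x \<le> y"
    by (rule countable_cofinal_subset_real[where R = "(\<lambda>d. unorm (\<phi> d e)) ` J"])
  have "\<exists>H. countable H \<and> H \<subseteq> J \<and> C = (\<lambda>d. unorm (\<phi> d e)) ` H"
    using C(1,2) by (simp flip: countable_subset_image)
  then obtain H where H: "H \<subseteq> J" "countable H" "C = (\<lambda>d. unorm (\<phi> d e)) ` H"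
    by (elim exE conjE)
  have "\<exists>m\<in>J \<inter> span (G \<union> H). \<forall>e'\<in>insert e F. \<phi> m e' = \<phi> d e'" if "d \<in> J" for d
  proof -
    have "\<exists>m\<in>J \<inter> span H. \<phi> m e = \<phi> d e"
    proof (cases "\<phi> d e = 0")
      case True
      then show ?thesis
        using J(2) span_zero by (intro bexI[of _ 0]) auto
    next
      case False
      obtain g where g: "g \<in> H" "unorm (\<phi> d e) \<le> unorm (\<phi> g e)"
        using bspec[OF C(3) imageI[OF \<open>d \<in> J\<close>]] by (auto simp: H(3))
      have pos: "0 < unorm (\<phi> g e)"
        using g(2) False unorm_ge_zero[of "\<phi> d e"] unorm_eq_zero[of "\<phi> d e"] by linarith
      let ?a = "\<phi> d e * inverse (\<phi> g e)"
      have "unorm ?a = unorm (\<phi> d e) / unorm (\<phi> g e)"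
        by (simp only: unorm_mult unorm_inverse divide_inverse)
      then have "unorm ?a \<le> 1"
        using g(2) pos by simp
      then have "scl ?a g \<in> J"
        using J(4) g(1) H(1) by blast
      moreover have "\<phi> (scl ?a g) e = \<phi> d e"
      proof -
        have "g \<in> D" "\<phi> g e \<noteq> 0"
          using pos g(1) H(1) J(1) by auto
        then show ?thesis
          by (simp add: coord_scale)
      qed
      ultimately show ?thesis
        using span_scale[OF span_base[OF g(1)]] by blast
    qed
    then obtain m where m: "m \<in> J" "m \<in> span H" "\<phi> m e = \<phi> d e"
      by blast
    have eq: "\<phi> (d - m) e' = \<phi> d e' - \<phi> m e'" for e'
      using \<open>d \<in> J\<close> m(1) J(1) by (intro coord_diff) auto
    obtain n where n: "n \<in> J" "n \<in> span G" "\<phi> n e = 0" "\<And>e'. e' \<in> F \<Longrightarrow> \<phi> n e' = \<phi> (d - m) e'"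
      using G'[OF J_diff[OF \<open>d \<in> J\<close> m(1)]] m(3) by (auto simp: eq)
    have "\<phi> (m + n) e' = \<phi> d e'" if "e' \<in> insert e F" for e'
      using that m n J(1) by (auto simp: coord_add eq subset_iff)
    moreover have "m + n \<in> J"
      using J(3) m(1) n(1) by blast
    moreover have "m + n \<in> span (G \<union> H)"
      using m(2) n(2) span_mono[of G "G \<union> H"] span_mono[of H "G \<union> H"]
      by (intro span_add) auto
    ultimately show ?thesis
      by blast
  qed
  moreover have "G \<union> H \<subseteq> J" "countable (G \<union> H)"
    using G(1,2) H(1,2) by (auto simp: J0_def)
  ultimately show ?case
    by blast
qed

text \<open>
  For each finite set \<open>F\<close> of coordinates and each bound \<open>r\<close> in \<open>{0, 1}\<close>, the values on \<open>F\<close> of the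
  vectors bounded by \<open>r\<close> off \<open>A0 \<union> F\<close> are generated by countably many such vectors. A countable
  set \<open>A1\<close> containing the supports, off \<open>A0\<close>, of all the generators belonging to its own finite
  subsets has the required properties. The bound 0 is needed for trivial valuations only, where
  scalars of small norm are lacking.
\<close>

lemma good_extension_countable:
  assumes A0: "good A0"
  shows "\<exists>A1 S. e0 \<in> A1 \<and> good (A0 \<union> A1) \<and> countable S \<and> S \<subseteq> supported (A0 \<union> A1) \<and>
    (\<forall>d\<in>supported (A0 \<union> A1). \<forall>\<epsilon>>0. \<exists>s\<in>span S. \<forall>e. e \<notin> A0 \<longrightarrow> unorm (\<phi> (d - s) e) \<le> \<epsilon>)"
proof -
  define J where "J F r = {d \<in> D. \<forall>e. e \<notin> A0 \<union> F \<longrightarrow> unorm (\<phi> d e) \<le> r}" for F and r :: real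
  define gen where "gen F r G \<longleftrightarrow> G \<subseteq> J F r \<and> countable G \<and>
      (\<forall>d\<in>J F r. \<exists>m\<in>J F r \<inter> span G. \<forall>e\<in>F. \<phi> m e = \<phi> d e)" for F r G
  have "\<exists>G. gen F r G"
    if "finite F" "0 \<le> r" for F r
    unfolding gen_def
  proof (rule countable_generators[OF \<open>finite F\<close>])
    fix a :: 'k and u assume "unorm a \<le> 1" "u \<in> J F r"
    moreover have "unorm (a * \<phi> u e) \<le> r" if "unorm (\<phi> u e) \<le> r" for e
      using mult_mono[OF \<open>unorm a \<le> 1\<close> that] by (simp add: unorm_mult)
    ultimately show "scl a u \<in> J F r"
      by (auto simp: J_def coord_scale)
  qed (use \<open>0 \<le> r\<close> in \<open>auto simp: J_def coord_add unorm_add_leI\<close>)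
  then have "\<exists>G. finite F \<and> 0 \<le> r \<longrightarrow> gen F r G" for F r
    by blast
  then obtain G where "\<And>F r. finite F \<Longrightarrow> 0 \<le> r \<Longrightarrow> gen F r (G F r)"
    by metis
  then have G: "\<And>F r. finite F \<Longrightarrow> 0 \<le> r \<Longrightarrow> G F r \<subseteq> J F r"
      "\<And>F r. finite F \<Longrightarrow> 0 \<le> r \<Longrightarrow> countable (G F r)"
      "\<And>F r d. finite F \<Longrightarrow> 0 \<le> r \<Longrightarrow> d \<in> J F r \<Longrightarrow>
        \<exists>m\<in>J F r \<inter> span (G F r). \<forall>e\<in>F. \<phi> m e = \<phi> d e"
    by (simp_all add: gen_def)
  define h where "h F = (\<Union>g\<in>G F 0 \<union> G F 1. {e. \<phi> g e \<noteq> 0})" for F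
  have "countable (h F)" if "finite F" for F
    unfolding h_def using G(1)[OF that, of 0] G(1)[OF that, of 1] G(2)[OF that]
    by (intro countable_UN countable_Un countable_support) (auto simp: J_def)
  then obtain A1 where A1: "e0 \<in> A1" "countable A1" "\<And>F. finite F \<Longrightarrow> F \<subseteq> A1 \<Longrightarrow> h F \<subseteq> A1"
    using countable_closure_under_finite_subsets[of h "{e0}"] by auto
  define \<F> where "\<F> = {F. finite F \<and> F \<subseteq> A1}"
  define S where "S = (\<Union>F\<in>\<F>. G F 0 \<union> G F 1)"
  have "countable \<F>"
    unfolding \<F>_def by (rule countable_Collect_finite_subset[OF A1(2)])
  then have "countable S"
    unfolding S_def using G(2) by (intro countable_UN) (auto simp: \<F>_def)
  have S_D: "S \<subseteq> D"
    using G(1)[of _ 0] G(1)[of _ 1] by (fastforce simp: S_def \<F>_def J_def)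
  have S_supp: "S \<subseteq> supported (A0 \<union> A1)"
    using S_D A1(3) by (fastforce simp: S_def \<F>_def supported_def h_def)
  have span_D: "s \<in> D" if "s \<in> span S" for s
    using span_subset_D[OF S_D that] .
  \<comment> \<open>Dividing by \<open>c\<close> reduces to the bound 1, so that countably many generators serve all bounds.\<close>
  have approx: "\<exists>s\<in>span S. \<forall>e. e \<notin> A0 \<longrightarrow> unorm (\<phi> (d - s) e) \<le> unorm c"
    if d: "d \<in> D" and c: "c \<noteq> 0" and off: "\<And>e. e \<notin> A0 \<union> A1 \<Longrightarrow> unorm (\<phi> d e) \<le> unorm c" for d and c :: 'k
  proof -
    have pos: "0 < unorm c"
      using c unorm_ge_zero[of c] by (simp add: less_le unorm_eq_zero)
    let ?F = "{e \<in> A1. unorm c < unorm (\<phi> d e)}"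
    have F: "finite ?F"
      by (rule rev_finite_subset[OF coord_null[OF d pos]]) auto
    let ?d = "scl (inverse c) d"
    have "unorm (\<phi> ?d e) \<le> 1" if "e \<notin> A0 \<union> ?F" for e
    proof -
      have "unorm (\<phi> d e) \<le> unorm c"
        using off[of e] that by (cases "e \<in> A1") auto
      moreover have "unorm (\<phi> ?d e) = unorm (\<phi> d e) / unorm c"
        by (simp only: coord_scale[OF d] unorm_mult unorm_inverse divide_inverse mult.commute)
      ultimately show ?thesis
        using pos by simp
    qed
    then have "?d \<in> J ?F 1"
      using d by (auto simp: J_def)
    then obtain m where m: "m \<in> J ?F 1" "m \<in> span (G ?F 1)" "\<And>e. e \<in> ?F \<Longrightarrow> \<phi> m e = \<phi> ?d e"
      using G(3)[OF F, of 1] by fastforce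
    have "G ?F 1 \<subseteq> S"
      using F by (auto simp: S_def \<F>_def)
    then have "m \<in> span S"
      using m(2) span_mono by blast
    have mD: "m \<in> D"
      using m(1) by (simp add: J_def)
    have "unorm (\<phi> (d - scl c m) e) \<le> unorm c" if "e \<notin> A0" for e
    proof (cases "e \<in> ?F")
      case True
      then have "\<phi> (d - scl c m) e = 0"
        using c d mD m(3) by (simp add: coord_diff coord_scale D_closed)
      then show ?thesis
        by simp
    next
      case False
      then have "unorm (\<phi> d e) \<le> unorm c"
        using off[of e] that by (cases "e \<in> A1") auto
      moreover have "unorm (c * \<phi> m e) \<le> unorm c"
        using m(1) False that by (simp add: J_def unorm_mult mult_left_le)
      ultimately show ?thesis
        using d mD by (simp add: coord_diff coord_scale D_closed unorm_diff_leI)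
    qed
    then show ?thesis
      using span_scale[OF \<open>m \<in> span S\<close>] by blast
  qed
  have "good (A0 \<union> A1)"
  proof (rule goodI)
    fix d p
    assume d: "d \<in> D" and p: "\<phi> d p \<noteq> 0" "\<And>e. e \<notin> A0 \<union> A1 \<Longrightarrow> unorm (\<phi> d e) \<le> unorm (\<phi> d p)"
    then obtain s where s: "s \<in> span S" "\<And>e. e \<notin> A0 \<Longrightarrow> unorm (\<phi> (d - s) e) \<le> unorm (\<phi> d p)"
      using approx by blast
    obtain m where m: "m \<in> supported A0" "unorm (d - s - m) \<le> unorm (\<phi> d p)"
      using goodE[OF A0 D_closed(3)[OF d span_D[OF s(1)]] unorm_ge_zero s(2)] by blast
    have "s \<in> supported (A0 \<union> A1)"
      using span_minimal[OF S_supp subspace_supported] s(1) by blast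
    moreover have "m \<in> supported (A0 \<union> A1)"
      using m(1) supported_mono by blast
    ultimately have "s + m \<in> supported (A0 \<union> A1)"
      by (rule subspace_add[OF subspace_supported])
    then show "\<exists>m\<in>supported (A0 \<union> A1). unorm (d - m) \<le> unorm (\<phi> d p)"
      using m(2) by (intro bexI[of _ "s + m"]) (simp_all add: diff_diff_eq)
  qed
  moreover have "\<exists>s\<in>span S. \<forall>e. e \<notin> A0 \<longrightarrow> unorm (\<phi> (d - s) e) \<le> \<epsilon>"
    if d: "d \<in> supported (A0 \<union> A1)" and "0 < \<epsilon>" for d \<epsilon>
  proof (cases "\<exists>c::'k. c \<noteq> 0 \<and> unorm c \<le> \<epsilon>")
    case True
    then obtain c :: 'k where c: "c \<noteq> 0" "unorm c \<le> \<epsilon>"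
      by blast
    then show ?thesis
      using approx[of d c] d order_trans[OF _ c(2)] by (fastforce simp: supported_def)
  next
    case False
    \<comment> \<open>The valuation is trivial, and all vectors have finite support.\<close>
    have dD: "d \<in> D"
      using d by (simp add: supported_def)
    let ?F = "{e \<in> A1. \<phi> d e \<noteq> 0}"
    have F: "finite ?F"
      using False by (intro rev_finite_subset[OF coord_null[OF dD \<open>0 < \<epsilon>\<close>]]) (auto simp: not_le less_imp_le)
    have "d \<in> J ?F 0"
      using d by (auto simp: J_def supported_def)
    then obtain m where m: "m \<in> J ?F 0" "m \<in> span (G ?F 0)" "\<And>e. e \<in> ?F \<Longrightarrow> \<phi> m e = \<phi> d e"
      using G(3)[OF F, of 0] by fastforce
    have mD: "m \<in> D"
      using m(1) by (simp add: J_def)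
    have "G ?F 0 \<subseteq> S"
      using F by (auto simp: S_def \<F>_def)
    then have "m \<in> span S"
      using m(2) span_mono by blast
    moreover have "unorm (\<phi> (d - m) e) \<le> \<epsilon>" if "e \<notin> A0" for e
    proof -
      have "\<phi> (d - m) e = 0"
      proof (cases "e \<in> ?F")
        case True
        then show ?thesis
          using m(3) dD mD by (simp add: coord_diff)
      next
        case ne: False
        then have "unorm (\<phi> m e) \<le> 0"
          using m(1) that by (auto simp: J_def)
        then have "\<phi> m e = 0"
          using unorm_ge_zero[of "\<phi> m e"] by (simp add: unorm_eq_zero)
        moreover have "\<phi> d e = 0"
          using ne that d by (auto simp: supported_def)
        ultimately show ?thesis
          using dD mD by (simp add: coord_diff)
      qed
      then show ?thesis
        using \<open>0 < \<epsilon>\<close> by simp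
    qed
    ultimately show ?thesis
      by blast
  qed
  ultimately show ?thesis
    using A1(1) \<open>countable S\<close> S_supp by blast
qed

section \<open>Gram-Schmidt orthonormalisation\<close>

text \<open>
  State of a Gram-Schmidt process on the coordinates outside \<open>A\<close>: \<open>P\<close> is a set of pivots for the
  finite set \<open>Y\<close>. Every vector can be cleared at all pivots by a combination of \<open>Y\<close>, and the norm of
  a combination of \<open>Y\<close> is attained at a pivot.
\<close>

definition pivoted :: "'e set \<Rightarrow> 'v set \<Rightarrow> 'e set \<Rightarrow> bool" where
  "pivoted A Y P \<longleftrightarrow> finite Y \<and> Y \<subseteq> D \<and> P \<inter> A = {} \<and> (\<forall>y\<in>Y. unorm y \<le> 1) \<and>
    (\<forall>s\<in>D. \<exists>t\<in>span Y. \<forall>p\<in>P. \<phi> (s - t) p = 0) \<and>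
    (\<forall>c. \<forall>y\<in>Y. \<exists>p\<in>P. unorm (c y) \<le> unorm (\<phi> (\<Sum>y\<in>Y. scl (c y) y) p))"

lemma pivoted_empty: "pivoted A {} {}"
  by (auto simp: pivoted_def)

lemma pivoted_insert:
  assumes Y: "pivoted A Y P" and y: "y \<in> D" "unorm y \<le> 1"
    and p: "p \<notin> A" "\<phi> y p = 1" "\<And>q. q \<in> P \<Longrightarrow> \<phi> y q = 0"
  shows "pivoted A (insert y Y) (insert p P)"
proof -
  have fin: "finite Y" and YD: "Y \<subseteq> D" and disj: "P \<inter> A = {}" and le: "\<And>x. x \<in> Y \<Longrightarrow> unorm x \<le> 1"
    and clear: "\<And>s. s \<in> D \<Longrightarrow> \<exists>t\<in>span Y. \<forall>q\<in>P. \<phi> (s - t) q = 0"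
    and piv: "\<And>c x. x \<in> Y \<Longrightarrow> \<exists>q\<in>P. unorm (c x) \<le> unorm (\<phi> (\<Sum>x\<in>Y. scl (c x) x) q)"
    using Y by (auto simp: pivoted_def)
  have notin: "y \<notin> Y"
  proof
    assume "y \<in> Y"
    then obtain q where "q \<in> P"
        "unorm (if y = y then 1 else (0::'k)) \<le>
          unorm (\<phi> (\<Sum>x\<in>Y. scl (if x = y then 1 else 0) x) q)"
      using piv[of y "\<lambda>x. if x = y then 1 else 0"] by blast
    moreover have "(\<Sum>x\<in>Y. scl (if x = y then 1 else 0) x) = (\<Sum>x\<in>Y. if x = y then y else 0)"
      by (rule sum.cong) auto
    ultimately show False
      using fin \<open>y \<in> Y\<close> p(3) by simp
  qed
  have "\<exists>t\<in>span (insert y Y). \<forall>q\<in>insert p P. \<phi> (s - t) q = 0" if s: "s \<in> D" for s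
  proof -
    obtain t where t: "t \<in> span Y" "\<And>q. q \<in> P \<Longrightarrow> \<phi> (s - t) q = 0"
      using clear[OF s] by blast
    have st: "s - t \<in> D"
      using s span_subset_D[OF YD t(1)] by blast
    let ?t = "t + scl (\<phi> (s - t) p) y"
    have "\<phi> (s - ?t) q = 0" if "q \<in> insert p P" for q
    proof -
      have "\<phi> (s - ?t) q = \<phi> (s - t - scl (\<phi> (s - t) p) y) q"
        by (simp only: diff_diff_eq)
      also have "\<dots> = \<phi> (s - t) q - \<phi> (s - t) p * \<phi> y q"
        by (simp only: coord_diff[OF st D_closed(4)[OF y(1)]] coord_scale[OF y(1)])
      finally have "\<phi> (s - ?t) q = \<phi> (s - t) q - \<phi> (s - t) p * \<phi> y q" .
      then show ?thesis
        using that t(2) p(2,3) by auto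
    qed
    moreover have "?t \<in> span (insert y Y)"
      using t(1) span_mono[of Y "insert y Y"] by (intro span_add span_scale[OF span_base]) auto
    ultimately show ?thesis
      by blast
  qed
  moreover have "\<exists>q\<in>insert p P. unorm (c x) \<le> unorm (\<phi> (\<Sum>x\<in>insert y Y. scl (c x) x) q)"
    if x: "x \<in> insert y Y" for c x
  proof -
    let ?u = "\<Sum>x\<in>Y. scl (c x) x"
    have uD: "?u \<in> D"
      using YD by auto
    have sum: "\<phi> (\<Sum>x\<in>insert y Y. scl (c x) x) q = c y * \<phi> y q + \<phi> ?u q" for q
      using fin notin uD y(1) by (simp add: coord_add coord_scale D_closed)
    have old: "\<exists>q\<in>P. unorm (c x) \<le> unorm (\<phi> (\<Sum>x\<in>insert y Y. scl (c x) x) q)" if "x \<in> Y" for x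
      using piv[OF that, of c] p(3) by (simp add: sum)
    have "\<exists>q\<in>insert p P. unorm (c y) \<le> unorm (\<phi> (\<Sum>x\<in>insert y Y. scl (c x) x) q)"
    proof (rule ccontr)
      assume neg: "\<not> ?thesis"
      \<comment> \<open>Then \<open>c y\<close> strictly dominates, and at \<open>p\<close> it cannot be cancelled by the older terms.\<close>
      have small: "unorm (c x) < unorm (c y)" if "x \<in> Y" for x
        using old[OF that] neg by (meson insertCI le_less_trans not_le)
      have "unorm (\<phi> ?u p) < unorm (c y)"
      proof (cases "Y = {}")
        case True
        then show ?thesis
          using neg p(2) coord_scale[OF y(1)] by auto
      next
        case False
        let ?M = "Max ((\<lambda>x. unorm (c x)) ` Y)"
        have M: "?M \<in> (\<lambda>x. unorm (c x)) ` Y" "\<And>x. x \<in> Y \<Longrightarrow> unorm (c x) \<le> ?M"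
          using fin False by (auto intro: Max_in)
        then have "unorm ?u \<le> ?M"
          using le by (intro unorm_lincomb_le) auto
        moreover have "?M < unorm (c y)"
          using M(1) small by auto
        ultimately show ?thesis
          using unorm_coord_le[OF uD, of p] by linarith
      qed
      then have "unorm (\<phi> ?u p + c y) = unorm (c y)"
        by (rule unorm_add_eq_right)
      then show False
        using neg p(2) by (simp add: sum add.commute)
    qed
    with old x show ?thesis
      by blast
  qed
  ultimately show ?thesis
    unfolding pivoted_def using fin YD y disj p(1) le by blast
qed

text \<open>
  A vector \<open>s\<close> is cleared at the pivots and normalised at its largest coordinate outside \<open>A\<close>, which
  becomes the next pivot. Goodness of \<open>A\<close> makes the norm of the result at most one by subtracting
  a vector supported in \<open>A\<close>, which does not change the coordinates outside \<open>A\<close>.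
\<close>

lemma pivoted_step:
  assumes A: "good A" "A \<subseteq> B" and Y: "pivoted A Y P" "Y \<subseteq> supported B" and s: "s \<in> supported B"
  shows "\<exists>Y' P'. pivoted A Y' P' \<and> Y \<subseteq> Y' \<and> Y' \<subseteq> supported B \<and> (\<exists>t\<in>span Y'. s - t \<in> supported A)"
proof -
  have sD: "s \<in> D"
    using s by (simp add: supported_def)
  then obtain t where t: "t \<in> span Y" "\<And>p. p \<in> P \<Longrightarrow> \<phi> (s - t) p = 0"
    using Y(1) by (auto simp: pivoted_def)
  have tB: "t \<in> supported B"
    using span_minimal[OF Y(2) subspace_supported] t(1) by blast
  define w where "w = s - t"
  have w: "w \<in> supported B" "w \<in> D"
    using subspace_diff[OF subspace_supported s tB] by (simp_all add: w_def supported_def)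
  show ?thesis
  proof (cases "w \<in> supported A")
    case True
    then show ?thesis
      using Y t(1) by (auto simp: w_def)
  next
    case False
    then obtain e where "e \<in> - A" "\<phi> w e \<noteq> 0"
      using w(2) by (auto simp: supported_def)
    then obtain p where p: "p \<in> - A" "\<phi> w p \<noteq> 0"
        "\<And>e. e \<in> - A \<Longrightarrow> unorm (\<phi> w e) \<le> unorm (\<phi> w p)"
      using coord_max[OF w(2)] by metis
    let ?c = "\<phi> w p"
    have pos: "0 < unorm ?c"
      using p(2) unorm_ge_zero[of ?c] by (simp add: less_le unorm_eq_zero)
    define z where "z = scl (inverse ?c) w"
    have z: "z \<in> supported B" "z \<in> D"
      using w subspace_scale[OF subspace_supported] by (auto simp: z_def)
    have z_coord: "\<phi> z e = inverse ?c * \<phi> w e" for e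
      using w(2) by (simp add: z_def coord_scale)
    have "unorm (\<phi> z e) \<le> 1" if "e \<notin> A" for e
    proof -
      have "unorm (\<phi> z e) = unorm (\<phi> w e) / unorm ?c"
        by (simp only: z_coord unorm_mult unorm_inverse divide_inverse mult.commute)
      then show ?thesis
        using p(3)[of e] that pos by simp
    qed
    then obtain m where m: "m \<in> supported A" "unorm (z - m) \<le> 1"
      using goodE[OF A(1) z(2), of 1] by auto
    define y where "y = z - m"
    have mD: "m \<in> D"
      using m(1) by (simp add: supported_def)
    have y: "y \<in> supported B" "y \<in> D"
      using subspace_diff[OF subspace_supported z(1)] m(1) supported_mono[OF A(2)]
      by (auto simp: y_def supported_def)
    have y_coord: "\<phi> y e = \<phi> z e" if "e \<notin> A" for e
      using that m(1) z(2) mD by (simp add: y_def coord_diff supported_def)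
    have "pivoted A (insert y Y) (insert p P)"
    proof (rule pivoted_insert[OF Y(1) y(2)])
      show "unorm y \<le> 1"
        using m(2) by (simp add: y_def)
      show "p \<notin> A"
        using p(1) by simp
      then show "\<phi> y p = 1"
        using p(2) by (simp add: y_coord z_coord)
      show "\<phi> y q = 0" if "q \<in> P" for q
      proof -
        have "q \<notin> A"
          using Y(1) that by (auto simp: pivoted_def)
        then show ?thesis
          using t(2)[OF that] by (simp add: y_coord z_coord w_def)
      qed
    qed
    moreover have "insert y Y \<subseteq> supported B"
      using y(1) Y(2) by blast
    moreover have "t + scl ?c y \<in> span (insert y Y)"
      using t(1) span_mono[of Y "insert y Y"] by (intro span_add span_scale[OF span_base]) auto
    moreover have "s - (t + scl ?c y) \<in> supported A"
    proof -
      have "scl ?c z = w"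
        using p(2) by (simp add: z_def)
      then have "s - (t + scl ?c y) = scl ?c m"
        by (simp add: y_def w_def scale_right_diff_distrib algebra_simps)
      then show ?thesis
        using m(1) subspace_scale[OF subspace_supported] by simp
    qed
    ultimately show ?thesis
      by blast
  qed
qed

text \<open>
  Vectors of norm at most one that become orthonormal, and stay of norm one, after deletion of the
  coordinates in \<open>A\<close>.
\<close>

definition orthonormal_off :: "'e set \<Rightarrow> 'v set \<Rightarrow> bool" where
  "orthonormal_off A Y \<longleftrightarrow> (\<forall>y\<in>Y. unorm y \<le> 1) \<and> (\<forall>F c. finite F \<longrightarrow> F \<subseteq> Y \<longrightarrow>
    (\<forall>y\<in>F. \<exists>p. p \<notin> A \<and> unorm (c y) \<le> unorm (\<phi> (\<Sum>y\<in>F. scl (c y) y) p)))"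

lemma orthonormal_offD:
  "orthonormal_off A Y \<Longrightarrow> y \<in> Y \<Longrightarrow> unorm y \<le> 1"
  "orthonormal_off A Y \<Longrightarrow> finite F \<Longrightarrow> F \<subseteq> Y \<Longrightarrow> y \<in> F \<Longrightarrow>
    \<exists>p. p \<notin> A \<and> unorm (c y) \<le> unorm (\<phi> (\<Sum>y\<in>F. scl (c y) y) p)"
  by (auto simp: orthonormal_off_def)

lemma gram_schmidt:
  assumes A: "good A" "A \<subseteq> B" and S: "countable S" "S \<subseteq> supported B"
  shows "\<exists>Y\<subseteq>supported B. orthonormal_off A Y \<and> (\<forall>s\<in>S. \<exists>t\<in>span Y. s - t \<in> supported A)"
proof (cases "S = {}")
  case True
  then show ?thesis
    by (intro exI[of _ "{}"]) (auto simp: orthonormal_off_def)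
next
  case False
  define s where "s = from_nat_into S"
  have range_s: "range s = S"
    using False S(1) by (simp add: s_def range_from_nat_into)
  define ok where "ok YP \<longleftrightarrow> pivoted A (fst YP) (snd YP) \<and> fst YP \<subseteq> supported B" for YP
  define step where "step n YP YP' \<longleftrightarrow> fst YP \<subseteq> fst YP' \<and> (\<exists>t\<in>span (fst YP'). s n - t \<in> supported A)"
    for n and YP YP' :: "'v set \<times> 'e set"
  have "\<exists>f. \<forall>n. ok (f n) \<and> step n (f n) (f (Suc n))"
  proof (rule dependent_nat_choice)
    show "\<exists>YP. ok YP"
      by (rule exI[of _ "({}, {})"]) (simp add: ok_def pivoted_empty)
    fix YP n assume "ok YP"
    moreover have "s n \<in> supported B"
      using range_s S(2) by auto
    ultimately obtain Y' P' where "pivoted A Y' P'" "fst YP \<subseteq> Y'" "Y' \<subseteq> supported B"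
        "\<exists>t\<in>span Y'. s n - t \<in> supported A"
      using pivoted_step[OF A, of "fst YP" "snd YP" "s n"] by (auto simp: ok_def)
    then show "\<exists>YP'. ok YP' \<and> step n YP YP'"
      by (intro exI[of _ "(Y', P')"]) (simp add: ok_def step_def)
  qed
  then obtain f where f: "\<And>n. ok (f n)" "\<And>n. step n (f n) (f (Suc n))"
    by blast
  define Y where "Y n = fst (f n)" for n
  define P where "P n = snd (f n)" for n
  have Y: "pivoted A (Y n) (P n)" "Y n \<subseteq> supported B" for n
    using f(1)[of n] by (simp_all add: ok_def Y_def P_def)
  have Y_step: "Y n \<subseteq> Y (Suc n)" "\<exists>t\<in>span (Y (Suc n)). s n - t \<in> supported A" for n
    using f(2)[of n] by (simp_all add: step_def Y_def)
  have mono: "Y m \<subseteq> Y n" if "m \<le> n" for m n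
    using that Y_step(1) by (rule lift_Suc_mono_le[rotated])
  show ?thesis
    unfolding orthonormal_off_def
  proof (intro exI[of _ "\<Union>n. Y n"] conjI ballI allI impI)
    show "(\<Union>n. Y n) \<subseteq> supported B"
      using Y(2) by blast
    show "unorm y \<le> 1" if "y \<in> (\<Union>n. Y n)" for y
      using that Y(1) by (auto simp: pivoted_def)
  next
    fix x assume "x \<in> S"
    then obtain n where "x = s n"
      using range_s by blast
    moreover obtain t where "t \<in> span (Y (Suc n))" "s n - t \<in> supported A"
      using Y_step(2) by blast
    moreover have "span (Y (Suc n)) \<subseteq> span (\<Union>n. Y n)"
      by (rule span_mono) blast
    ultimately show "\<exists>t\<in>span (\<Union>n. Y n). x - t \<in> supported A"
      by blast
  next
    fix F and c :: "'v \<Rightarrow> 'k" and y assume F: "finite F" "F \<subseteq> (\<Union>n. Y n)" "y \<in> F"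
    then obtain n where n: "F \<subseteq> Y n"
      using finite_subset_UN_incseq[OF F(1,2) mono] by blast
    define d where "d y = (if y \<in> F then c y else 0)" for y
    have "finite (Y n)"
      using Y(1)[of n] by (simp add: pivoted_def)
    then have "(\<Sum>y\<in>F. scl (c y) y) = (\<Sum>y\<in>Y n. scl (d y) y)"
      using n by (intro sum.mono_neutral_cong_left) (auto simp: d_def)
    moreover obtain p where "p \<in> P n" "unorm (d y) \<le> unorm (\<phi> (\<Sum>y\<in>Y n. scl (d y) y) p)"
      using Y(1)[of n] n F(3) unfolding pivoted_def by blast
    moreover have "P n \<inter> A = {}"
      using Y(1)[of n] by (simp add: pivoted_def)
    ultimately show "\<exists>p. p \<notin> A \<and> unorm (c y) \<le> unorm (\<phi> (\<Sum>y\<in>F. scl (c y) y) p)"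
      using F(3) by (intro exI[of _ p]) (auto simp: d_def)
  qed
qed

text \<open>
  An orthonormal set whose combinations have norms attained off \<open>A\<close> stays orthonormal when an
  orthonormal set of vectors supported in \<open>A\<close> is adjoined.
\<close>

lemma orthonormal_extension:
  assumes A: "good A" and X: "orthonormal X" "X \<subseteq> supported A" "supported A \<subseteq> closure (span X)"
  shows "\<exists>B Z. insert e A \<subseteq> B \<and> X \<subseteq> Z \<and> good B \<and> orthonormal Z \<and> Z \<subseteq> supported B \<and>
    supported B \<subseteq> closure (span Z)"
proof -
  obtain A1 S where "e \<in> A1" and B: "good (A \<union> A1)"
      and S: "countable S" "S \<subseteq> supported (A \<union> A1)"
        "\<And>d \<epsilon>. d \<in> supported (A \<union> A1) \<Longrightarrow> 0 < \<epsilon> \<Longrightarrow>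
          \<exists>s\<in>span S. \<forall>e. e \<notin> A \<longrightarrow> unorm (\<phi> (d - s) e) \<le> \<epsilon>"
    using good_extension_countable[OF A, of e] by blast
  let ?B = "A \<union> A1"
  obtain Y where Y: "Y \<subseteq> supported ?B" and Y_on: "orthonormal_off A Y"
      and Y_span: "\<forall>s\<in>S. \<exists>t\<in>span Y. s - t \<in> supported A"
    using gram_schmidt[OF A _ S(1,2)] by blast
  note Y_le = orthonormal_offD(1)[OF Y_on]
  have AB: "supported A \<subseteq> supported ?B"
    by (rule supported_mono) blast
  have YD: "Y \<subseteq> D"
    using Y by (auto simp: supported_def)
  have "orthonormal (X \<union> Y)"
    unfolding orthonormal_def
  proof (intro conjI ballI allI impI)
    show "unorm x \<le> 1" if "x \<in> X \<union> Y" for x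
      using that Y_le orthonormalD(1)[OF X(1)] by blast
  next
    fix F and c :: "'v \<Rightarrow> 'k" and x assume F: "finite F" "F \<subseteq> X \<union> Y" "x \<in> F"
    let ?FX = "F \<inter> X" and ?FY = "F - X"
    let ?u = "\<Sum>x\<in>?FX. scl (c x) x" and ?v = "\<Sum>x\<in>?FY. scl (c x) x"
    have fin: "finite ?FX" "finite ?FY" "?FX \<subseteq> X" "?FY \<subseteq> Y"
      using F by auto
    have sum: "(\<Sum>x\<in>F. scl (c x) x) = ?u + ?v"
      using sum.Int_Diff[OF F(1)] by blast
    have uA: "?u \<in> supported A"
      using X(2) by (intro subspace_sum[OF subspace_supported] subspace_scale[OF subspace_supported]) auto
    then have uD: "?u \<in> D"
      by (simp add: supported_def)
    have vD: "?v \<in> D"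
      using fin(4) YD by auto
    have le_Y: "unorm (c y) \<le> unorm (?u + ?v)" if y: "y \<in> ?FY" for y
    proof -
      obtain p where "p \<notin> A" "unorm (c y) \<le> unorm (\<phi> ?v p)"
        using orthonormal_offD(2)[OF Y_on fin(2,4) y] by blast
      moreover have "\<phi> (?u + ?v) p = \<phi> ?v p" if "p \<notin> A" for p
        using that uA uD vD by (simp add: coord_add supported_def)
      ultimately show ?thesis
        using unorm_coord_le[OF D_closed(2)[OF uD vD], of p] by simp
    qed
    have "unorm ?v \<le> unorm (?u + ?v)"
      using le_Y fin(4) Y_le by (intro unorm_lincomb_le) auto
    then have "unorm ?u \<le> unorm (?u + ?v)"
      using unorm_diff_leI[of "?u + ?v" "unorm (?u + ?v)" ?v] by simp
    then have "unorm (c y) \<le> unorm (?u + ?v)" if "y \<in> ?FX" for y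
      using orthonormalD(2)[OF X(1) fin(1,3) that, of c] by linarith
    with le_Y F(3) show "unorm (c x) \<le> unorm (\<Sum>x\<in>F. scl (c x) x)"
      unfolding sum by blast
  qed
  moreover have "supported ?B \<subseteq> closure (span (X \<union> Y))"
  proof
    fix d assume d: "d \<in> supported ?B"
    have sub: "subspace (closure (span (X \<union> Y)))"
      by (rule subspace_closure[OF subspace_span])
    have "span X \<subseteq> span (X \<union> Y)" "span Y \<subseteq> span (X \<union> Y)"
      by (rule span_mono; blast)+
    then have inA: "supported A \<subseteq> closure (span (X \<union> Y))"
      and inY: "span Y \<subseteq> closure (span (X \<union> Y))"
      using X(3) closure_mono[of "span X" "span (X \<union> Y)"] closure_subset[of "span (X \<union> Y)"] by blast+
    have "S \<subseteq> closure (span (X \<union> Y))"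
    proof
      fix s assume "s \<in> S"
      then obtain t where "t \<in> span Y" "s - t \<in> supported A"
        using Y_span by blast
      then show "s \<in> closure (span (X \<union> Y))"
        using subspace_add[OF sub, of "s - t" t] inA inY by auto
    qed
    then have inS: "span S \<subseteq> closure (span (X \<union> Y))"
      by (rule span_minimal[OF _ sub])
    have "d \<in> closure (closure (span (X \<union> Y)))"
      unfolding in_closure_iff_unorm[of d]
    proof (intro allI impI)
      fix \<epsilon> :: real assume "0 < \<epsilon>"
      then obtain s where s: "s \<in> span S" "\<And>e. e \<notin> A \<Longrightarrow> unorm (\<phi> (d - s) e) \<le> \<epsilon>"
        using S(3)[OF d] by blast
      have "d - s \<in> D"
        using d s(1) span_minimal[OF S(2) subspace_supported] by (auto simp: supported_def)
      then obtain m where "m \<in> supported A" "unorm (d - s - m) \<le> \<epsilon>"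
        using goodE[OF A _ _ s(2)] \<open>0 < \<epsilon>\<close> by (metis less_imp_le)
      then show "\<exists>w\<in>closure (span (X \<union> Y)). unorm (d - w) \<le> \<epsilon>"
        using subspace_add[OF sub, of s m] s(1) inS inA
        by (intro bexI[of _ "s + m"]) (auto simp: diff_diff_eq)
    qed
    then show "d \<in> closure (span (X \<union> Y))"
      by simp
  qed
  moreover have "X \<union> Y \<subseteq> supported ?B"
    using X(2) Y AB by blast
  ultimately show ?thesis
    using \<open>e \<in> A1\<close> B by (intro exI[of _ ?B] exI[of _ "X \<union> Y"]) auto
qed

section \<open>Subspaces of free spaces\<close>

text \<open>
  Zorn's lemma is applied to pairs of a good set \<open>A\<close> and an orthonormal set spanning a dense subspace
  of the vectors supported in \<open>A\<close>, ordered by inclusion in both components; such a pair is encoded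
  as a subset of the sum type.
\<close>

theorem orthonormal_basis_exists: "\<exists>X\<subseteq>D. orthonormal X \<and> D \<subseteq> closure (span X)"
proof -
  define \<Q> where "\<Q> = {Z :: ('e + 'v) set. good (Inl -` Z) \<and> orthonormal (Inr -` Z) \<and>
    Inr -` Z \<subseteq> supported (Inl -` Z) \<and> supported (Inl -` Z) \<subseteq> closure (span (Inr -` Z))}"
  have "\<exists>M\<in>\<Q>. \<forall>Z\<in>\<Q>. M \<subseteq> Z \<longrightarrow> Z = M"
  proof (rule subset_Zorn_nonempty)
    have "supported {} \<subseteq> closure (span {})"
    proof
      fix v assume v: "v \<in> supported {}"
      then have "v \<in> D" "\<forall>e. unorm (\<phi> v e) \<le> 0"
        by (auto simp: supported_def)
      then have "unorm v \<le> 0"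
        using norm_le_iff[of v 0] by simp
      then have "v = 0"
        using unorm_ge_zero[of v] by (simp add: unorm_eq_zero)
      then show "v \<in> closure (span {})"
        by simp
    qed
    then have "{} \<in> \<Q>"
      by (simp add: \<Q>_def good_empty orthonormal_def)
    then show "\<Q> \<noteq> {}"
      by blast
  next
    fix C assume "C \<noteq> {}" and chain: "subset.chain \<Q> C"
    then have CQ: "Z \<in> \<Q>" if "Z \<in> C" for Z
      using that by (auto simp: subset.chain_def)
    define A where "A = Inl -` \<Union>C"
    define X where "X = Inr -` \<Union>C"
    have fin_A: "\<exists>Z\<in>C. F \<subseteq> Inl -` Z" if "finite F" "F \<subseteq> A" for F
    proof -
      have "finite (Inl ` F :: ('e + 'v) set)" "Inl ` F \<subseteq> \<Union>C"
        using that by (auto simp: A_def)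
      then obtain Z where "Z \<in> C" "Inl ` F \<subseteq> Z"
        using finite_subset_Union_chain[OF _ _ \<open>C \<noteq> {}\<close> chain] by metis
      then show ?thesis
        by blast
    qed
    have fin_X: "\<exists>Z\<in>C. F \<subseteq> Inr -` Z" if "finite F" "F \<subseteq> X" for F
    proof -
      have "finite (Inr ` F :: ('e + 'v) set)" "Inr ` F \<subseteq> \<Union>C"
        using that by (auto simp: X_def)
      then obtain Z where "Z \<in> C" "Inr ` F \<subseteq> Z"
        using finite_subset_Union_chain[OF _ _ \<open>C \<noteq> {}\<close> chain] by metis
      then show ?thesis
        by blast
    qed
    have sub_A: "supported (Inl -` Z) \<subseteq> supported A" if "Z \<in> C" for Z
      using that by (intro supported_mono) (auto simp: A_def)
    \<comment> \<open>Only finitely many coordinates exceed a given bound; some member of the chain contains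
      those that lie in \<open>A\<close>.\<close>
    have reduce: "\<exists>Z\<in>C. \<exists>m\<in>supported (Inl -` Z). unorm (d - m) \<le> r"
      if d: "d \<in> D" and "0 < r" and off: "\<And>e. e \<notin> A \<Longrightarrow> unorm (\<phi> d e) \<le> r" for d r
    proof -
      let ?F = "{e \<in> A. r < unorm (\<phi> d e)}"
      have "finite ?F"
        by (rule rev_finite_subset[OF coord_null[OF d \<open>0 < r\<close>]]) auto
      then obtain Z where Z: "Z \<in> C" "?F \<subseteq> Inl -` Z"
        using fin_A[of ?F] by blast
      then have "good (Inl -` Z)"
        using CQ by (simp add: \<Q>_def)
      moreover have "unorm (\<phi> d e) \<le> r" if "e \<notin> Inl -` Z" for e
        using off[of e] that Z(2) by (cases "e \<in> A") auto
      ultimately obtain m where "m \<in> supported (Inl -` Z)" "unorm (d - m) \<le> r"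
        using goodE[of "Inl -` Z" d r] d \<open>0 < r\<close> by auto
      with Z(1) show ?thesis
        by blast
    qed
    have "good A"
    proof (rule goodI)
      fix d p assume d: "d \<in> D" and p: "\<phi> d p \<noteq> 0"
          "\<And>e. e \<notin> A \<Longrightarrow> unorm (\<phi> d e) \<le> unorm (\<phi> d p)"
      have "0 < unorm (\<phi> d p)"
        using p(1) unorm_ge_zero[of "\<phi> d p"] by (simp add: less_le unorm_eq_zero)
      then show "\<exists>m\<in>supported A. unorm (d - m) \<le> unorm (\<phi> d p)"
        using reduce[OF d _ p(2)] sub_A by blast
    qed
    moreover have "orthonormal X"
      unfolding orthonormal_def
    proof (intro conjI ballI allI impI)
      show "unorm x \<le> 1" if "x \<in> X" for x
        using that CQ orthonormalD(1) by (fastforce simp: X_def \<Q>_def)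
    next
      fix F and c :: "'v \<Rightarrow> 'k" and x assume F: "finite F" "F \<subseteq> X" "x \<in> F"
      then obtain Z where Z: "Z \<in> C" "F \<subseteq> Inr -` Z"
        using fin_X by blast
      then have "orthonormal (Inr -` Z)"
        using CQ by (simp add: \<Q>_def)
      then show "unorm (c x) \<le> unorm (\<Sum>x\<in>F. scl (c x) x)"
        using F(1) Z(2) F(3) by (rule orthonormalD(2))
    qed
    moreover have "X \<subseteq> supported A"
    proof
      fix x assume "x \<in> X"
      then obtain Z where "Z \<in> C" "x \<in> Inr -` Z"
        by (auto simp: X_def)
      then show "x \<in> supported A"
        using CQ[of Z] sub_A[of Z] by (auto simp: \<Q>_def)
    qed
    moreover have "supported A \<subseteq> closure (span X)"
    proof
      fix d assume d: "d \<in> supported A"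
      have "d \<in> closure (closure (span X))"
        unfolding in_closure_iff_unorm[of d]
      proof (intro allI impI)
        fix \<epsilon> :: real assume "0 < \<epsilon>"
        then obtain Z m where Z: "Z \<in> C" "m \<in> supported (Inl -` Z)" "unorm (d - m) \<le> \<epsilon>"
          using reduce[of d \<epsilon>] d by (auto simp: supported_def)
        have "Inr -` Z \<subseteq> X"
          using Z(1) by (auto simp: X_def)
        then have "closure (span (Inr -` Z)) \<subseteq> closure (span X)"
          by (intro closure_mono span_mono)
        moreover have "m \<in> closure (span (Inr -` Z))"
          using CQ[OF Z(1)] Z(2) by (auto simp: \<Q>_def)
        ultimately show "\<exists>m\<in>closure (span X). unorm (d - m) \<le> \<epsilon>"
          using Z(3) by blast
      qed
      then show "d \<in> closure (span X)"
        by simp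
    qed
    ultimately show "\<Union>C \<in> \<Q>"
      by (simp add: \<Q>_def A_def X_def)
  qed
  then obtain M where M: "M \<in> \<Q>" "\<And>Z. Z \<in> \<Q> \<Longrightarrow> M \<subseteq> Z \<Longrightarrow> Z = M"
    by blast
  let ?A = "Inl -` M" and ?X = "Inr -` M"
  have AX: "good ?A" "orthonormal ?X" "?X \<subseteq> supported ?A" "supported ?A \<subseteq> closure (span ?X)"
    using M(1) by (auto simp: \<Q>_def)
  have "e \<in> ?A" for e
  proof -
    obtain B Z where BZ: "insert e ?A \<subseteq> B" "?X \<subseteq> Z" "good B" "orthonormal Z" "Z \<subseteq> supported B"
        "supported B \<subseteq> closure (span Z)"
      using orthonormal_extension[OF AX, of e] by blast
    have vim: "Inl -` (Inl ` B \<union> Inr ` Z) = B" "Inr -` (Inl ` B \<union> Inr ` Z) = Z"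
      by auto
    have "Inl ` B \<union> Inr ` Z \<in> \<Q>"
      unfolding \<Q>_def mem_Collect_eq vim using BZ by blast
    moreover have "M \<subseteq> Inl ` B \<union> Inr ` Z"
    proof
      fix z assume "z \<in> M"
      then show "z \<in> Inl ` B \<union> Inr ` Z"
        using BZ(1,2) by (cases z) auto
    qed
    ultimately have "Inl ` B \<union> Inr ` Z = M"
      by (rule M(2))
    then show ?thesis
      using BZ(1) by auto
  qed
  then have "supported ?A = D"
    by (auto simp: supported_def)
  with AX show ?thesis
    by (intro exI[of _ ?X]) auto
qed

end

context banach_kvs
begin

text \<open>Gruson's theorem. Closedness of \<open>D\<close> is immaterial: bases need only represent its vectors.\<close>

theorem free_subspace_subset:
  assumes "free_subspace scl W" "subspace D" "D \<subseteq> W"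
  shows "free_subspace scl D"
proof -
  obtain E where E: "orthonormal E" "W \<subseteq> closure (span E)"
    using assms(1) by (auto simp: free_subspace_def orthonormal_schauder_basis_iff)
  define \<phi> where "\<phi> v = (SOME c. is_coords E v c)" for v
  have \<phi>: "is_coords E v (\<phi> v)" if "v \<in> D" for v
  proof -
    have "v \<in> closure (span E)"
      using that assms(3) E(2) by blast
    then show ?thesis
      unfolding \<phi>_def by (rule someI_ex[OF is_coords_exists[OF E(1)]])
  qed
  interpret null_coordinates scl D \<phi>
  proof
    fix u v e assume uv: "u \<in> D" "v \<in> D"
    have "\<phi> (u + v) = (\<lambda>x. \<phi> u x + \<phi> v x)"
      by (rule is_coords_unique[OF E(1) \<phi>[OF subspace_add[OF assms(2) uv]]
            is_coords_add[OF E(1) \<phi>[OF uv(1)] \<phi>[OF uv(2)]]])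
    then show "\<phi> (u + v) e = \<phi> u e + \<phi> v e"
      by simp
  next
    fix v a e assume v: "v \<in> D"
    have "\<phi> (scl a v) = (\<lambda>x. a * \<phi> v x)"
      by (rule is_coords_unique[OF E(1) \<phi>[OF subspace_scale[OF assms(2) v]]
            is_coords_scale[OF E(1) \<phi>[OF v]]])
    then show "\<phi> (scl a v) e = a * \<phi> v e"
      by simp
  next
    fix v and \<epsilon> :: real assume "v \<in> D" "0 < \<epsilon>"
    then show "finite {e. \<epsilon> \<le> unorm (\<phi> v e)}"
      using is_coords_null \<phi> by blast
  next
    fix v and r :: real assume "v \<in> D" "0 \<le> r"
    then show "unorm v \<le> r \<longleftrightarrow> (\<forall>e. unorm (\<phi> v e) \<le> r)"
      using is_coords_norm_le_iff[OF E(1) \<phi>] by blast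
  qed (rule assms(2))
  show ?thesis
    using orthonormal_basis_exists by (auto simp: free_subspace_def orthonormal_schauder_basis_iff)
qed

end

section \<open>Almost free spaces and filtrations\<close>

lemma regularCard_bounded_image:
  assumes r: "Card_order r" "regularCard r" and S: "|S| <o r" and b: "b ` S \<subseteq> Field r"
  shows "\<exists>a\<in>Field r. \<forall>s\<in>S. b s = a \<or> b s \<in> underS r a"
proof -
  have "|b ` S| <o r"
    using card_of_image S by (rule ordLeq_ordLess_trans)
  then have "\<not> cofinal (b ` S) r"
    using r(2) b not_ordLess_ordIso unfolding regularCard_def by blast
  then obtain a where a: "a \<in> Field r" "\<And>s. s \<in> S \<Longrightarrow> a = b s \<or> (a, b s) \<notin> r"
    by (auto simp: cofinal_def)
  have "total_on (Field r) r"
    using r(1) by (simp add: card_order_on_def well_order_on_def linear_order_on_def)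
  then have "b s = a \<or> b s \<in> underS r a" if "s \<in> S" for s
    using a(1) a(2)[OF that] b that by (auto simp: total_on_def underS_def)
  then show ?thesis
    using a(1) by blast
qed

context banach_kvs
begin

lemma free_filtration_imp_almost_free:
  assumes reg: "regularCard (banach_rank scl)" and F: "free_filtration scl F"
  shows "almost_free scl"
  unfolding almost_free_def kappa_free_def
proof
  let ?\<kappa> = "banach_rank scl"
  have small: "\<And>\<alpha>. \<alpha> \<in> Field ?\<kappa> \<Longrightarrow> F \<alpha> \<in> small_subspaces scl ?\<kappa>"
    and free: "\<And>\<alpha>. \<alpha> \<in> Field ?\<kappa> \<Longrightarrow> free_subspace scl (F \<alpha>)"
    and mono: "\<And>\<alpha> \<beta>. \<alpha> \<in> Field ?\<kappa> \<Longrightarrow> \<beta> \<in> underS ?\<kappa> \<alpha> \<Longrightarrow> F \<beta> \<subseteq> F \<alpha>"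
    and cover: "UNIV = (\<Union>\<beta>\<in>Field ?\<kappa>. F \<beta>)"
    using F by (auto simp: free_filtration_def Let_def)
  fix W assume "W \<in> small_subspaces scl ?\<kappa>"
  then obtain S where S: "W = closed_lin_span scl S" "|S| <o ?\<kappa>"
    by (auto simp: small_subspaces_def)
  have "\<forall>s. \<exists>\<beta>. \<beta> \<in> Field ?\<kappa> \<and> s \<in> F \<beta>"
    using cover by blast
  then obtain b where b: "\<And>s. b s \<in> Field ?\<kappa>" "\<And>s. s \<in> F (b s)"
    by metis
  obtain \<alpha> where \<alpha>: "\<alpha> \<in> Field ?\<kappa>" "\<forall>s\<in>S. b s = \<alpha> \<or> b s \<in> underS ?\<kappa> \<alpha>"
    using regularCard_bounded_image[OF rank_minimal(1) reg S(2), of b] b(1) by blast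
  have "S \<subseteq> F \<alpha>"
  proof
    fix s assume "s \<in> S"
    with \<alpha>(2) have "b s = \<alpha> \<or> b s \<in> underS ?\<kappa> \<alpha>"
      by (rule bspec)
    then have "F (b s) \<subseteq> F \<alpha>"
      using mono[OF \<alpha>(1)] by (elim disjE) simp_all
    then show "s \<in> F \<alpha>"
      using b(2) by (rule subsetD)
  qed
  moreover obtain T where "F \<alpha> = closed_lin_span scl T"
    using small[OF \<alpha>(1)] by (auto simp: small_subspaces_def)
  ultimately have "W \<subseteq> F \<alpha>"
    using closed_lin_span_minimal[of S "F \<alpha>"] subspace_closed_lin_span
    by (simp add: S(1) closed_lin_span_def)
  then show "free_subspace scl W"
    using free_subspace_subset[OF free[OF \<alpha>(1)]] subspace_closed_lin_span by (simp add: S(1))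
qed

text \<open>The filtration consists of the closed spans of the initial segments of an enumeration of \<open>V\<close>.\<close>

lemma almost_free_imp_free_filtration:
  assumes card: "|UNIV :: 'v set| =o banach_rank scl" and inf: "cinfinite (banach_rank scl)"
    and free: "almost_free scl"
  shows "\<exists>F. free_filtration scl F"
proof -
  let ?\<kappa> = "banach_rank scl"
  have \<kappa>: "Card_order ?\<kappa>" "\<not> finite (Field ?\<kappa>)"
    using rank_minimal(1) inf by (auto simp: cinfinite_def)
  have "|Field ?\<kappa>| =o |UNIV :: 'v set|"
    using card card_of_Field_ordIso[OF \<kappa>(1)] ordIso_symmetric ordIso_transitive by blast
  then obtain f where f: "bij_betw f (Field ?\<kappa>) (UNIV :: 'v set)"
    using card_of_ordIso by blast
  define F where "F \<alpha> = closed_lin_span scl (f ` underS ?\<kappa> \<alpha>)" for \<alpha>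
  have small: "F \<alpha> \<in> small_subspaces scl ?\<kappa>" if "\<alpha> \<in> Field ?\<kappa>" for \<alpha>
    using ordLeq_ordLess_trans[OF card_of_image card_of_underS[OF \<kappa>(1) that]]
    by (auto simp: small_subspaces_def F_def)
  have trans: "trans ?\<kappa>" and antisym: "antisym ?\<kappa>"
    using \<kappa>(1) by (auto simp: card_order_on_def well_order_on_def linear_order_on_def
        partial_order_on_def preorder_on_def)
  have F_mono: "F \<beta> \<subseteq> F \<alpha>" if "\<beta> \<in> underS ?\<kappa> \<alpha>" for \<alpha> \<beta>
    unfolding F_def using that underS_incr[OF trans antisym, of \<beta> \<alpha>]
    by (intro closed_lin_span_mono image_mono) (auto simp: underS_def)
  have in_F: "f \<beta> \<in> F \<alpha>" if "\<beta> \<in> underS ?\<kappa> \<alpha>" for \<alpha> \<beta>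
    unfolding F_def using that subset_closed_lin_span by blast
  have "F \<alpha> = closed_lin_span scl (\<Union>\<beta>\<in>underS ?\<kappa> \<alpha>. F \<beta>)" if "nonzero_limit ?\<kappa> \<alpha>" for \<alpha>
  proof
    have "f ` underS ?\<kappa> \<alpha> \<subseteq> (\<Union>\<beta>\<in>underS ?\<kappa> \<alpha>. F \<beta>)"
      using that in_F by (fastforce simp: nonzero_limit_def)
    then show "F \<alpha> \<subseteq> closed_lin_span scl (\<Union>\<beta>\<in>underS ?\<kappa> \<alpha>. F \<beta>)"
      unfolding F_def by (rule closed_lin_span_mono)
    show "closed_lin_span scl (\<Union>\<beta>\<in>underS ?\<kappa> \<alpha>. F \<beta>) \<subseteq> F \<alpha>"
    proof (rule closed_lin_span_minimal)
      show "(\<Union>\<beta>\<in>underS ?\<kappa> \<alpha>. F \<beta>) \<subseteq> F \<alpha>"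
        using F_mono by blast
      show "subspace (F \<alpha>)"
        unfolding F_def by (rule subspace_closed_lin_span)
      show "closed (F \<alpha>)"
        by (simp add: F_def closed_lin_span_def)
    qed
  qed
  moreover have "v \<in> (\<Union>\<beta>\<in>Field ?\<kappa>. F \<beta>)" for v
  proof -
    obtain \<beta> where "\<beta> \<in> Field ?\<kappa>" "v = f \<beta>"
      using f by (metis UNIV_I bij_betw_imp_surj_on imageE)
    moreover obtain \<gamma> where "\<gamma> \<in> Field ?\<kappa>" "\<beta> \<noteq> \<gamma>" "(\<beta>, \<gamma>) \<in> ?\<kappa>"
      using infinite_Card_order_limit[OF \<kappa> \<open>\<beta> \<in> Field ?\<kappa>\<close>] by blast
    ultimately show ?thesis
      using in_F[of \<beta> \<gamma>] by (auto simp: underS_def)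
  qed
  ultimately have "free_filtration scl F"
    using small F_mono free
    by (auto simp: free_filtration_def Let_def almost_free_def kappa_free_def)
  then show ?thesis
    by blast
qed

end

theorem proposition4p9:
  fixes scl :: "'k::complete_valuation_field \<Rightarrow> 'v::complete_ultranormed_group \<Rightarrow> 'v"
  assumes "banach_kvs scl"
    and "|UNIV :: 'v set| =o banach_rank scl"
    and "cinfinite (banach_rank scl)" and "regularCard (banach_rank scl)"
  shows "almost_free scl \<longleftrightarrow> (\<exists>F. free_filtration scl F)"
proof -
  interpret banach_kvs scl
    by (rule assms(1))
  show ?thesis
    using almost_free_imp_free_filtration[OF assms(2,3)] free_filtration_imp_almost_free[OF assms(4)]
    by blast
qed

end
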